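(* Suppose that $\eta$ is $(\alpha,A)$-smooth in $(\mathcal X,\rho,\mu)$ with $\alpha\in(0,1]$, $A>0$, and satisfies the $(\beta,B)$-margin condition with $\beta\ge0$, $B>0$. Then there exists a fixed constant $c\in(0,1)$ such that for $L=\lceil(1-c)M\rceil$, if $kM=\Theta(N^{\frac{2\alpha}{2\alpha+1}})$ (with $k$ and $M$ allowed to vary with $N$), then, as $N\to\infty$, $$\mathbb E_{\mathcal P}[R(g_{k,M,L})]-R^*=O\bigl(N^{-\frac{\alpha(\beta+1)}{2\alpha+1}}\bigr)\quad\text{and}\quad\mathrm{CIS}_N(g_{k,M,L})=O\bigl(N^{-\frac{\alpha\beta}{2\alpha+1}}\bigr),$$ where $g_{k,M,L}$ is the $L$-selective $M$-split $k$-NN classifier.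
   Context: Setting. $(\mathcal X,\rho)$ is a separable metric space, $\mathcal Y=\{0,1\}$, $(X,Y)\sim\mathsf P$ on $\mathcal X\times\mathcal Y$, $\mu$ is the marginal of $X$, $\eta(x)=\Pr(Y=1|X=x)$. $B^o(x,r)$ and $\overline B(x,r)$ are open and closed balls; $\mathrm{supp}(\mu)=\{x:\mu(B^o(x,r))>0\ \forall r>0\}$; $\eta(S)=\frac1{\mu(S)}\int_S\eta\,d\mu$ for $\mu(S)>0$. $g^*(x)=\mathbf 1\{\eta(x)\ge1/2\}$; $R(g)=\Pr(g(X)\ne Y)$, $R^*=R(g^* )$. Distance ties are assumed not to occur (for every $x$, almost surely the distances from $x$ to the sample points are distinct). Assumptions. $(\alpha,A)$-smooth: $|\eta(\overline B(x,r))-\eta(x)|\le A\,\mu(B^o(x,r))^\alpha$ for all $x\in\mathrm{supp}(\mu)$, $r>0$. $(\beta,B)$-margin: $\mu(\{x\in\mathrm{supp}(\mu):|\eta(x)-\frac12|\le\Delta\})\le B\Delta^\beta$ for all $\Delta\in(0,\frac12]$. Rule. $N$ i.i.d. samples from $\mathsf P$ are split at random into $M$ disjoint subsets $\mathcal D_m=(\mathbf X_m,\mathbf Y_m)$ of equal size $n=N/M$ ($M$ divides $N$, $n\ge k+1$); $\mathcal P=\{\mathcal D_1,\dots,\mathcal D_M\}$. $r_k(x;\mathbf X)$ is the distance from $x$ to its $k$-th nearest neighbor in $\mathbf X$; $\eta_k(x;\mathcal D)$ is the average of the labels of the $k$ nearest neighbors of $x$ in $\mathcal D$. For $1\le L\le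 M$, let $m_1,\dots,m_L$ be the indices of the $L$ smallest values among $(r_{k+1}(x;\mathbf X_m))_{m=1}^M$; then $\eta_{k,M,L}(x)=\frac1L\sum_{j=1}^L\eta_k(x;\mathcal D_{m_j})$ and $g_{k,M,L}(x)=\mathbf 1\{\eta_{k,M,L}(x)\ge\frac12\}$. Classification instability: for a classification procedure $\hat g$ mapping a dataset $\mathcal D$ of size $N$ to a classifier $\hat g(\cdot;\mathcal D)$, $\mathrm{CIS}_N(\hat g)=\mathbb E[\Pr(\hat g(X;\mathcal D)\ne\hat g(X;\mathcal D')|\mathcal D,\mathcal D')]$ where $\mathcal D,\mathcal D'$ are independent i.i.d. datasets of size $N$, and $X\sim\mu$ is independent of them. *)

theory Defs
  imports "HOL-Probability.Probability" "HOL-Library.Landau_Symbols"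
begin

text \<open>
  A separable metric space is a type of class \<^class>\<open>metric_space\<close> and
  \<^class>\<open>second_countable_topology\<close>. Labels are of type \<^typ>\<open>bool\<close>, with \<^term>\<open>True\<close> for the label 1.
\<close>

definition joint_law :: "('a::{metric_space, second_countable_topology} \<times> bool) measure \<Rightarrow> bool" where
  "joint_law P \<longleftrightarrow> prob_space P \<and> sets P = sets (borel \<Otimes>\<^sub>M count_space UNIV)"

definition marginal :: "('a::{metric_space, second_countable_topology} \<times> bool) measure \<Rightarrow> 'a measure" where
  "marginal P = distr P borel fst"

text \<open>
  \<open>\<eta>\<close> is a version of the conditional probability of the label 1 given \<open>X\<close>, i.e. given the
  \<open>\<sigma>\<close>-algebra generated by the first projection. It is a function defined everywhere, because the
  smoothness condition below constrains its value at every point of the support.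
\<close>

definition regression_function ::
    "('a::{metric_space, second_countable_topology} \<times> bool) measure \<Rightarrow> ('a \<Rightarrow> real) \<Rightarrow> bool" where
  "regression_function P \<eta> \<longleftrightarrow>
     \<eta> \<in> borel_measurable borel \<and> (\<forall>x. 0 \<le> \<eta> x \<and> \<eta> x \<le> 1) \<and>
     (AE z in P. \<eta> (fst z) =
        real_cond_exp P (vimage_algebra (space P) fst borel) (\<lambda>z. of_bool (snd z)) z)"

definition msupport :: "'a::metric_space measure \<Rightarrow> 'a set" where
  "msupport \<mu> = {x. \<forall>r>0. measure \<mu> (ball x r) > 0}"

definition avg_on :: "'a measure \<Rightarrow> ('a \<Rightarrow> real) \<Rightarrow> 'a set \<Rightarrow> real" where
  "avg_on \<mu> \<eta> S = (1 / measure \<mu> S) * (LINT x:S|\<mu>. \<eta> x)"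

definition smooth :: "'a::metric_space measure \<Rightarrow> ('a \<Rightarrow> real) \<Rightarrow> real \<Rightarrow> real \<Rightarrow> bool" where
  "smooth \<mu> \<eta> \<alpha> A \<longleftrightarrow>
     (\<forall>x\<in>msupport \<mu>. \<forall>r>0. \<bar>avg_on \<mu> \<eta> (cball x r) - \<eta> x\<bar> \<le> A * measure \<mu> (ball x r) powr \<alpha>)"

definition margin :: "'a::metric_space measure \<Rightarrow> ('a \<Rightarrow> real) \<Rightarrow> real \<Rightarrow> real \<Rightarrow> bool" where
  "margin \<mu> \<eta> \<beta> B \<longleftrightarrow>
     (\<forall>\<Delta>\<in>{0<..1/2}. measure \<mu> {x \<in> msupport \<mu>. \<bar>\<eta> x - 1/2\<bar> \<le> \<Delta>} \<le> B * \<Delta> powr \<beta>)"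

definition risk :: "('a \<times> bool) measure \<Rightarrow> ('a \<Rightarrow> bool) \<Rightarrow> real" where
  "risk P g = \<P>(z in P. g (fst z) \<noteq> snd z)"

definition bayes :: "('a \<Rightarrow> real) \<Rightarrow> 'a \<Rightarrow> bool" where
  "bayes \<eta> x \<longleftrightarrow> \<eta> x \<ge> 1/2"

definition sample :: "('a \<times> bool) measure \<Rightarrow> nat \<Rightarrow> (nat \<Rightarrow> 'a \<times> bool) measure" where
  "sample P N = (\<Pi>\<^sub>M i\<in>{..<N}. P)"

definition no_ties :: "('a::metric_space \<times> bool) measure \<Rightarrow> bool" where
  "no_ties P \<longleftrightarrow>
     (\<forall>x N. AE D in sample P N. inj_on (\<lambda>i. dist x (fst (D i))) {..<N})"

text \<open>
  A split assigns to each sample index \<open>i < N\<close> the number \<open>m < M\<close> of its subset, all subsets having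
  the same size; the random split is uniform over these assignments and independent of the sample.
  The \<open>m\<close>-th subset is given by its set of sample indices.
\<close>

definition splits :: "nat \<Rightarrow> nat \<Rightarrow> (nat \<Rightarrow> nat) set" where
  "splits N M = {s \<in> {..<N} \<rightarrow>\<^sub>E {..<M}. \<forall>m<M. card {i. i < N \<and> s i = m} = N div M}"

definition random_split :: "nat \<Rightarrow> nat \<Rightarrow> (nat \<Rightarrow> nat) measure" where
  "random_split N M = uniform_count_measure (splits N M)"

definition subsample :: "nat \<Rightarrow> (nat \<Rightarrow> nat) \<Rightarrow> nat \<Rightarrow> nat set" where
  "subsample N s m = {i. i < N \<and> s i = m}"

text \<open>
  Neighbours within a set \<open>I\<close> of sample indices, nearest first. Sorting is stable, so ties
  would be broken by index.
\<close>

definition neighbours :: "(nat \<Rightarrow> 'a::metric_space \<times> bool) \<Rightarrow> nat set \<Rightarrow> 'a \<Rightarrow> nat list" where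
  "neighbours D I x = sort_key (\<lambda>i. dist x (fst (D i))) (sorted_list_of_set I)"

definition nn_dist :: "nat \<Rightarrow> (nat \<Rightarrow> 'a::metric_space \<times> bool) \<Rightarrow> nat set \<Rightarrow> 'a \<Rightarrow> real" where
  "nn_dist k D I x = dist x (fst (D (neighbours D I x ! (k - 1))))"

definition knn_avg :: "nat \<Rightarrow> (nat \<Rightarrow> 'a::metric_space \<times> bool) \<Rightarrow> nat set \<Rightarrow> 'a \<Rightarrow> real" where
  "knn_avg k D I x = (1 / real k) * (\<Sum>i\<leftarrow>take k (neighbours D I x). of_bool (snd (D i)))"

definition selected ::
    "nat \<Rightarrow> nat \<Rightarrow> nat \<Rightarrow> nat \<Rightarrow> (nat \<Rightarrow> 'a::metric_space \<times> bool) \<Rightarrow> (nat \<Rightarrow> nat) \<Rightarrow> 'a \<Rightarrow> nat list" where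
  "selected N k M L D s x =
     take L (sort_key (\<lambda>m. nn_dist (k + 1) D (subsample N s m) x) [0..<M])"

definition selective_avg ::
    "nat \<Rightarrow> nat \<Rightarrow> nat \<Rightarrow> nat \<Rightarrow> (nat \<Rightarrow> 'a::metric_space \<times> bool) \<Rightarrow> (nat \<Rightarrow> nat) \<Rightarrow> 'a \<Rightarrow> real" where
  "selective_avg N k M L D s x =
     (1 / real L) * (\<Sum>m\<leftarrow>selected N k M L D s x. knn_avg k D (subsample N s m) x)"

definition selective_knn ::
    "nat \<Rightarrow> nat \<Rightarrow> nat \<Rightarrow> nat \<Rightarrow> (nat \<Rightarrow> 'a::metric_space \<times> bool) \<Rightarrow> (nat \<Rightarrow> nat) \<Rightarrow> 'a \<Rightarrow> bool" where
  "selective_knn N k M L D s x \<longleftrightarrow> selective_avg N k M L D s x \<ge> 1/2"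

text \<open>
  Below, \<open>g D s\<close> is the classifier produced by a procedure \<open>g\<close> from the data set \<open>D\<close> and its
  internal randomness \<open>s\<close>, which has law \<open>U\<close> and is independent of \<open>D\<close>.
  In the instability, the two data sets are processed with independent internal randomness.
\<close>

definition expected_risk ::
    "('a \<times> bool) measure \<Rightarrow> nat \<Rightarrow> 's measure \<Rightarrow> ((nat \<Rightarrow> 'a \<times> bool) \<Rightarrow> 's \<Rightarrow> 'a \<Rightarrow> bool) \<Rightarrow> real" where
  "expected_risk P N U g = (LINT (D, s)|(sample P N \<Otimes>\<^sub>M U). risk P (g D s))"

definition CIS ::
    "('a::{metric_space, second_countable_topology} \<times> bool) measure \<Rightarrow> nat \<Rightarrow> 's measure \<Rightarrow>
      ((nat \<Rightarrow> 'a \<times> bool) \<Rightarrow> 's \<Rightarrow> 'a \<Rightarrow> bool) \<Rightarrow> real" where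
  "CIS P N U g =
     (LINT (D, D')|(sample P N \<Otimes>\<^sub>M sample P N).
        \<P>((x, s, s') in marginal P \<Otimes>\<^sub>M (U \<Otimes>\<^sub>M U). g D s x \<noteq> g D' s' x))"

text \<open>
  The limit \<open>N \<rightarrow> \<infinity>\<close> for given \<open>k\<close> and \<open>M\<close> (as functions of \<open>N\<close>), along those \<open>N\<close> for which the rule
  is defined. The restriction matters: \<open>M N\<close> dividing \<open>N\<close> for all \<open>N\<close> would force \<open>M N = 1\<close> at every prime.
\<close>

definition sizes_to_infinity :: "(nat \<Rightarrow> nat) \<Rightarrow> (nat \<Rightarrow> nat) \<Rightarrow> nat filter" where
  "sizes_to_infinity k M =
     inf at_top (principal {N. 1 \<le> k N \<and> 1 \<le> M N \<and> M N dvd N \<and> N div M N \<ge> k N + 1})"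

end

theory Submission
  imports Defs "HOL-Real_Asymp.Real_Asymp"
begin

text \<open>
  We take \<open>c = 1/2\<close>. Fix a query point \<open>x\<close> of the support and a split, let \<open>\<Delta> = |\<eta> x - 1/2|\<close>, and let
  \<open>r\<close> be the radius of a ball around \<open>x\<close> of mass \<open>p \<ge> 8 k M / N\<close>, where \<open>p\<close> is of the same order as
  \<open>k M / N\<close>; the spheres around \<open>x\<close> are null sets because there are no ties. Except with probability
  \<open>exp (- k M / 2)\<close>, more than half of the blocks have at least \<open>k + 1\<close> points in this ball, and then
  all selected pivots (the \<open>(k + 1)\<close>-st neighbours in the selected blocks) lie in it. Given the
  pivots, the \<open>k L\<close> voters are independent draws from balls of mass at most \<open>p\<close>, on which \<open>\<eta>\<close> has an
  average within \<open>A p powr \<alpha>\<close> of \<open>\<eta> x\<close>. So the rule disagrees with the Bayes rule at \<open>x\<close> with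
  probability at most \<open>exp (- k M / 2) + exp (- \<Delta>\<^sup>2 k M / 8)\<close> as soon as \<open>A p powr \<alpha> \<le> \<Delta> / 2\<close>. Here
  \<open>p powr \<alpha>\<close> and \<open>(k M) powr (- 1/2)\<close> are both of order \<open>N powr (- \<alpha> / (2 \<alpha> + 1))\<close>, and integrating this
  bound over shells of this width with the margin condition gives mass of order
  \<open>N powr (- \<alpha> \<beta> / (2 \<alpha> + 1))\<close>; the excess risk has the additional factor \<open>2 \<Delta>\<close>, and the
  instability is at most twice the probability of disagreeing with the Bayes rule.
\<close>

subsection \<open>Sorting\<close>

lemma sort_key_cong:
  assumes "\<And>i. i \<in> set xs \<Longrightarrow> f i = g i"
  shows "sort_key f xs = sort_key g xs"
proof -
  have insort: "insort_key f a ys = insort_key g a ys" if "f a = g a" "\<And>i. i \<in> set ys \<Longrightarrow> f i = g i" for a ys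
    using that by (induction ys) auto
  show ?thesis using assms
    by (induction xs) (auto intro!: insort)
qed

lemma measurable_insort_key:
  fixes f :: "'b \<Rightarrow> 'c::countable \<Rightarrow> real"
  assumes f: "\<And>i. (\<lambda>w. f w i) \<in> borel_measurable M"
  shows "(\<lambda>w. insort_key (f w) a ys) \<in> measurable M (count_space UNIV)"
proof (induction ys)
  case (Cons b ys)
  have [measurable]: "(\<lambda>w. b # insort_key (f w) a ys) \<in> measurable M (count_space UNIV)"
    by (rule measurable_compose[OF Cons]) auto
  note f[measurable]
  show ?case by simp
qed simp

text \<open>The tail is sorted first and is then a random list. Over a countable type of entries
  there are only countably many lists, so it suffices to insert into each fixed one.\<close>

lemma measurable_sort_key:
  fixes f :: "'b \<Rightarrow> 'c::countable \<Rightarrow> real"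
  assumes f: "\<And>i. (\<lambda>w. f w i) \<in> borel_measurable M"
  shows "(\<lambda>w. sort_key (f w) xs) \<in> measurable M (count_space UNIV)"
proof (induction xs)
  case (Cons a xs)
  have "(\<lambda>w. insort_key (f w) a (sort_key (f w) xs)) \<in> measurable M (count_space UNIV)"
    by (rule measurable_compose_countable[OF measurable_insort_key[OF f] Cons])
  then show ?case by simp
qed simp

lemma sort_key_nth_less_iff:
  assumes "inj_on f (set xs)" "distinct xs" "i < length xs" "j < length xs"
  shows "f (sort_key f xs ! i) < f (sort_key f xs ! j) \<longleftrightarrow> i < j"
proof -
  have less: "f (sort_key f xs ! i) < f (sort_key f xs ! j)" if "i < j" "j < length xs" for i j
  proof -
    have "map f (sort_key f xs) ! i \<le> map f (sort_key f xs) ! j"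
      using that by (intro sorted_nth_mono) auto
    moreover have "sort_key f xs ! i \<noteq> sort_key f xs ! j"
      using that assms(2) by (subst nth_eq_iff_index_eq) auto
    moreover have "sort_key f xs ! i \<in> set xs" "sort_key f xs ! j \<in> set xs"
      using that by (metis length_sort nth_mem order_less_trans set_sort)+
    ultimately show ?thesis
      using assms(1) that unfolding inj_on_def by (auto simp: less_le)
  qed
  show ?thesis
    using less[of i j] less[of j i] assms(3,4) by (cases i j rule: linorder_cases) auto
qed

text \<open>Without ties, an initial segment of the sorted list is cut out by one strict inequality,
  which frees the later arguments about nearest neighbours from lists.\<close>

lemma set_take_sort_key:
  assumes "inj_on f (set xs)" "distinct xs" "k < length xs"
  shows "set (take k (sort_key f xs)) = {i \<in> set xs. f i < f (sort_key f xs ! k)}"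
proof -
  have "{i \<in> set xs. f i < f (sort_key f xs ! k)}
      = {i \<in> set (sort_key f xs). f i < f (sort_key f xs ! k)}" by simp
  also have "\<dots> = {sort_key f xs ! j | j. j < length xs \<and> f (sort_key f xs ! j) < f (sort_key f xs ! k)}"
    unfolding in_set_conv_nth by auto
  also have "\<dots> = {sort_key f xs ! j | j. j < k}"
  proof -
    have "j < length xs \<and> f (sort_key f xs ! j) < f (sort_key f xs ! k) \<longleftrightarrow> j < k" for j
      using sort_key_nth_less_iff[OF assms(1,2) _ assms(3), of j] assms(3) by auto
    then show ?thesis by simp
  qed
  also have "\<dots> = set (take k (sort_key f xs))"
  proof -
    have "sort_key f xs ! j \<in> set (take k (sort_key f xs))" if "j < k" for j
      using that assms(3) by (auto simp: in_set_conv_nth intro!: exI[of _ j])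
    moreover have "\<exists>j<k. y = sort_key f xs ! j" if "y \<in> set (take k (sort_key f xs))" for y
      using that assms(3) by (auto simp: in_set_conv_nth)
    ultimately show ?thesis by blast
  qed
  finally show ?thesis by simp
qed

text \<open>The segment and the remainder are sorted as a whole, ties or not. This will compare the
  pivots of selected and unselected blocks.\<close>

lemma sort_key_take_le:
  assumes "a \<in> set (take l (sort_key f xs))" "b \<in> set xs" "b \<notin> set (take l (sort_key f xs))"
  shows "f a \<le> f b"
proof -
  have "b \<in> set (take l (sort_key f xs) @ drop l (sort_key f xs))"
    using assms(2) unfolding append_take_drop_id by simp
  with assms(3) have "b \<in> set (drop l (sort_key f xs))"
    unfolding set_append by blast
  moreover have "sorted (map f (take l (sort_key f xs) @ drop l (sort_key f xs)))" by simp
  ultimately show ?thesis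
    using assms(1) unfolding map_append sorted_append by auto
qed

text \<open>Without ties the rank determines the point. This is how a prescribed pivot is recognised
  as the true one.\<close>

lemma eq_if_card_less_eq:
  fixes f :: "'b \<Rightarrow> real"
  assumes "finite I" "inj_on f I" "a \<in> I" "b \<in> I"
    and "card {i \<in> I. f i < f a} = card {i \<in> I. f i < f b}"
  shows "a = b"
proof -
  have *: "card {i \<in> I. f i < f a} < card {i \<in> I. f i < f b}" if "a \<in> I" "b \<in> I" "f a < f b" for a b
    using that assms(1) by (intro psubset_card_mono) auto
  show ?thesis
    using *[of a b] *[of b a] assms(3-5) inj_onD[OF assms(2), of a b] by (cases "f a" "f b" rule: linorder_cases) auto
qed

subsection \<open>Conditioning on the pivots\<close>

text \<open>
  With the coordinates in \<open>J\<close> fixed, the event \<open>E\<close> is a product over the coordinates in \<open>K\<close>, so that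
  the weights can be integrated out one coordinate at a time.
\<close>

lemma nn_integral_pivot_le:
  fixes P :: "'z measure" and \<rho> :: "'z \<Rightarrow> real" and w :: "'z \<Rightarrow> ennreal" and J K :: "nat set"
  assumes P: "prob_space P" and fin: "finite J" "finite K" and disj: "J \<inter> K = {}"
    and [measurable]: "\<rho> \<in> borel_measurable P" "w \<in> borel_measurable P"
    and \<pi>: "\<And>i. i \<in> K \<Longrightarrow> \<pi> i \<in> J"
    and G[measurable]: "Measurable.pred (Pi\<^sub>M J (\<lambda>_. P)) G"
    and q: "\<And>y i. y \<in> space (Pi\<^sub>M J (\<lambda>_. P)) \<Longrightarrow> G y \<Longrightarrow> i \<in> K \<Longrightarrow>
      (\<integral>\<^sup>+z. w z * indicator {z. \<rho> z < \<rho> (y (\<pi> i))} z \<partial>P) \<le> q * (\<integral>\<^sup>+z. indicator {z. \<rho> z < \<rho> (y (\<pi> i))} z \<partial>P)"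
  defines "E \<equiv> {D. G (restrict D J) \<and> (\<forall>i\<in>K. \<rho> (D i) < \<rho> (D (\<pi> i)))}"
  shows "(\<integral>\<^sup>+D. indicator E D * (\<Prod>i\<in>K. w (D i)) \<partial>Pi\<^sub>M (J \<union> K) (\<lambda>_. P))
    \<le> q ^ card K * (\<integral>\<^sup>+D. indicator E D \<partial>Pi\<^sub>M (J \<union> K) (\<lambda>_. P))"
proof -
  interpret P: prob_space P by fact
  interpret product_sigma_finite "\<lambda>_::nat. P" by standard
  have \<pi>_meas: "(\<lambda>D. D (\<pi> i)) \<in> measurable (Pi\<^sub>M (J \<union> K) (\<lambda>_. P)) P" if "i \<in> K" for i
    using \<pi>[OF that] by (intro measurable_component_singleton) auto
  have E[measurable]: "Measurable.pred (Pi\<^sub>M (J \<union> K) (\<lambda>_. P)) (\<lambda>D. D \<in> E)"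
  proof -
    have 1: "(\<lambda>D. restrict D J) \<in> measurable (Pi\<^sub>M (J \<union> K) (\<lambda>_. P)) (Pi\<^sub>M J (\<lambda>_. P))"
      by (rule measurable_restrict_subset) auto
    note [measurable] = measurable_compose[OF 1 G]
    note [measurable] = \<pi>_meas
    have [measurable]: "Measurable.pred (Pi\<^sub>M (J \<union> K) (\<lambda>_. P)) (\<lambda>D. \<forall>i\<in>K. \<rho> (D i) < \<rho> (D (\<pi> i)))"
      using fin(2) by (intro pred_intros_finite) measurable
    show ?thesis unfolding E_def mem_Collect_eq by measurable
  qed
  define S where "S y i = {z. \<rho> z < \<rho> (y (\<pi> i))}" for y i
  \<comment> \<open>Stated for a general weight because it is used twice: for \<open>w\<close>, and
    for the constant 1 to turn the bound on the factors back into the integral of the indicator of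
    \<open>E\<close>.\<close>
  have fact: "(\<integral>\<^sup>+D. indicator E D * (\<Prod>i\<in>K. v (D i)) \<partial>Pi\<^sub>M (J \<union> K) (\<lambda>_. P))
     = (\<integral>\<^sup>+y. of_bool (G y) * (\<Prod>i\<in>K. \<integral>\<^sup>+z. v z * indicator (S y i) z \<partial>P) \<partial>Pi\<^sub>M J (\<lambda>_. P))"
    if [measurable]: "v \<in> borel_measurable P" for v :: "'z \<Rightarrow> ennreal"
  proof -
    have [measurable]: "(\<lambda>D. \<Prod>i\<in>K. v (D i)) \<in> borel_measurable (Pi\<^sub>M (J \<union> K) (\<lambda>_. P))"
      by (intro borel_measurable_prod_ennreal) measurable
    have "(\<integral>\<^sup>+D. indicator E D * (\<Prod>i\<in>K. v (D i)) \<partial>Pi\<^sub>M (J \<union> K) (\<lambda>_. P))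
      = (\<integral>\<^sup>+y. (\<integral>\<^sup>+u. indicator E (merge J K (y, u)) * (\<Prod>i\<in>K. v (merge J K (y, u) i)) \<partial>Pi\<^sub>M K (\<lambda>_. P)) \<partial>Pi\<^sub>M J (\<lambda>_. P))"
      by (rule product_nn_integral_fold[OF disj fin]) measurable
    also have "\<dots> = (\<integral>\<^sup>+y. of_bool (G y) * (\<Prod>i\<in>K. \<integral>\<^sup>+z. v z * indicator (S y i) z \<partial>P) \<partial>Pi\<^sub>M J (\<lambda>_. P))"
    proof (intro nn_integral_cong)
      fix y assume y: "y \<in> space (Pi\<^sub>M J (\<lambda>_. P))"
      then have restr: "restrict y J = y" by (auto simp: space_PiM PiE_def extensional_restrict)
      have eq: "indicator E (merge J K (y, u)) * (\<Prod>i\<in>K. v (merge J K (y, u) i))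
          = of_bool (G y) * (\<Prod>i\<in>K. v (u i) * indicator (S y i) (u i))" for u
      proof -
        have m: "merge J K (y, u) i = u i" "merge J K (y, u) (\<pi> i) = y (\<pi> i)" if "i \<in> K" for i
          using that \<pi>[OF that] disj by (auto simp: merge_def)
        have r: "restrict (merge J K (y, u)) J = y"
          using restr disj by simp
        have "indicator E (merge J K (y, u)) = of_bool (G y) * (\<Prod>i\<in>K. indicator (S y i) (u i) :: ennreal)"
        proof (cases "\<forall>i\<in>K. u i \<in> S y i")
          case True
          then show ?thesis by (auto simp: E_def r m S_def indicator_def)
        next
          case False
          then have "(\<Prod>i\<in>K. indicator (S y i) (u i) :: ennreal) = 0"
            using fin(2) by (auto intro!: prod_zero simp: indicator_def)
          moreover have "merge J K (y, u) \<notin> E" using False by (auto simp: E_def m S_def)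
          ultimately show ?thesis by simp
        qed
        then show ?thesis by (simp add: m prod.distrib mult_ac)
      qed
      have meas: "(\<lambda>z. v z * indicator (S y i) z) \<in> borel_measurable P" for i
        unfolding S_def by measurable
      have meas2: "(\<lambda>u. \<Prod>i\<in>K. v (u i) * indicator (S y i) (u i)) \<in> borel_measurable (Pi\<^sub>M K (\<lambda>_. P))"
      proof (intro borel_measurable_prod_ennreal)
        fix i assume "i \<in> K"
        then show "(\<lambda>u. v (u i) * indicator (S y i) (u i)) \<in> borel_measurable (Pi\<^sub>M K (\<lambda>_. P))"
          by (intro measurable_compose[where g="\<lambda>z. v z * indicator (S y i) z", OF _ meas]
              measurable_component_singleton)
      qed
      show "(\<integral>\<^sup>+u. indicator E (merge J K (y, u)) * (\<Prod>i\<in>K. v (merge J K (y, u) i)) \<partial>Pi\<^sub>M K (\<lambda>_. P))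
        = of_bool (G y) * (\<Prod>i\<in>K. \<integral>\<^sup>+z. v z * indicator (S y i) z \<partial>P)"
        unfolding eq using meas2
        by (subst nn_integral_cmult, simp, subst product_nn_integral_prod) (auto intro: fin meas)
    qed
    finally show ?thesis .
  qed
  have "(\<integral>\<^sup>+D. indicator E D * (\<Prod>i\<in>K. w (D i)) \<partial>Pi\<^sub>M (J \<union> K) (\<lambda>_. P))
     = (\<integral>\<^sup>+y. of_bool (G y) * (\<Prod>i\<in>K. \<integral>\<^sup>+z. w z * indicator (S y i) z \<partial>P) \<partial>Pi\<^sub>M J (\<lambda>_. P))"
    by (rule fact) measurable
  also have "\<dots> \<le> (\<integral>\<^sup>+y. q ^ card K * (of_bool (G y) * (\<Prod>i\<in>K. \<integral>\<^sup>+z. 1 * indicator (S y i) z \<partial>P)) \<partial>Pi\<^sub>M J (\<lambda>_. P))"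
  proof (intro nn_integral_mono)
    fix y assume y: "y \<in> space (Pi\<^sub>M J (\<lambda>_. P))"
    show "of_bool (G y) * (\<Prod>i\<in>K. \<integral>\<^sup>+z. w z * indicator (S y i) z \<partial>P)
      \<le> q ^ card K * (of_bool (G y) * (\<Prod>i\<in>K. \<integral>\<^sup>+z. 1 * indicator (S y i) z \<partial>P))"
    proof (cases "G y")
      case True
      have "(\<Prod>i\<in>K. \<integral>\<^sup>+z. w z * indicator (S y i) z \<partial>P) \<le> (\<Prod>i\<in>K. q * (\<integral>\<^sup>+z. indicator (S y i) z \<partial>P))"
        unfolding S_def by (rule prod_mono_ennreal, rule q[OF y True])
      with True show ?thesis by (simp add: prod.distrib)
    qed simp
  qed
  also have "\<dots> = q ^ card K * (\<integral>\<^sup>+y. (of_bool (G y) * (\<Prod>i\<in>K. \<integral>\<^sup>+z. 1 * indicator (S y i) z \<partial>P)) \<partial>Pi\<^sub>M J (\<lambda>_. P))"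
  proof (rule nn_integral_cmult)
    have "(\<lambda>y. \<integral>\<^sup>+z. 1 * indicator (S y i) z \<partial>P) \<in> borel_measurable (Pi\<^sub>M J (\<lambda>_. P))" if i: "i \<in> K" for i
    proof -
      note \<pi>[OF i, measurable]
      show ?thesis unfolding S_def by measurable
    qed
    then have [measurable]: "(\<lambda>y. \<Prod>i\<in>K. \<integral>\<^sup>+z. 1 * indicator (S y i) z \<partial>P) \<in> borel_measurable (Pi\<^sub>M J (\<lambda>_. P))"
      by (rule borel_measurable_prod_ennreal)
    show "(\<lambda>y. of_bool (G y) * (\<Prod>i\<in>K. \<integral>\<^sup>+z. 1 * indicator (S y i) z \<partial>P)) \<in> borel_measurable (Pi\<^sub>M J (\<lambda>_. P))"
      by measurable
  qed
  also have "\<dots> = q ^ card K * (\<integral>\<^sup>+D. indicator E D * (\<Prod>i\<in>K. 1) \<partial>Pi\<^sub>M (J \<union> K) (\<lambda>_. P))"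
    by (subst fact) auto
  finally show ?thesis by simp
qed

section \<open>Measurability of the neighbours, the selection and the vote\<close>

lemma joint_law_space: "joint_law P \<Longrightarrow> space P = UNIV"
  unfolding joint_law_def by (auto dest: sets_eq_imp_space_eq simp: space_pair_measure)

lemma measurable_PiM_component:
  assumes "space P = UNIV"
  shows "(\<lambda>D. D i) \<in> measurable (Pi\<^sub>M I (\<lambda>_. P)) P"
proof (cases "i \<in> I")
  case False
  then have "D i = undefined" if "D \<in> space (Pi\<^sub>M I (\<lambda>_. P))" for D
    using that by (auto simp: space_PiM PiE_def extensional_def)
  then show ?thesis
    using assms by (subst measurable_cong[where g="\<lambda>_. undefined"]) auto
qed (rule measurable_component_singleton)

lemma joint_law_measurable:
  assumes "joint_law P"
  shows "fst \<in> measurable P borel" "snd \<in> measurable P (count_space UNIV)"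
    "(\<lambda>z. dist x (fst z)) \<in> borel_measurable P"
proof -
  have [measurable_cong]: "sets P = sets (borel \<Otimes>\<^sub>M count_space UNIV)"
    using assms by (simp add: joint_law_def)
  show "fst \<in> measurable P borel" "snd \<in> measurable P (count_space UNIV)"
    "(\<lambda>z. dist x (fst z)) \<in> borel_measurable P"
    by measurable
qed

lemma measurable_neighbours:
  assumes "\<And>i. (\<lambda>\<omega>. dist (X \<omega>) (fst (D \<omega> i))) \<in> borel_measurable \<Omega>"
  shows "(\<lambda>\<omega>. neighbours (D \<omega>) I (X \<omega>)) \<in> measurable \<Omega> (count_space UNIV)"
  unfolding neighbours_def by (rule measurable_sort_key[OF assms])

lemma measurable_nn_dist:
  assumes "\<And>i. (\<lambda>\<omega>. dist (X \<omega>) (fst (D \<omega> i))) \<in> borel_measurable \<Omega>"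
  shows "(\<lambda>\<omega>. nn_dist k (D \<omega>) I (X \<omega>)) \<in> borel_measurable \<Omega>"
  unfolding nn_dist_def
  by (rule measurable_compose_countable[OF assms
        measurable_compose[OF measurable_neighbours[OF assms], where g="\<lambda>l. l ! (k - 1)"]]) simp

lemma measurable_selected:
  assumes "\<And>i. (\<lambda>\<omega>. dist (X \<omega>) (fst (D \<omega> i))) \<in> borel_measurable \<Omega>"
  shows "(\<lambda>\<omega>. selected N k M L (D \<omega>) s (X \<omega>)) \<in> measurable \<Omega> (count_space UNIV)"
  unfolding selected_def
  by (rule measurable_compose[where g="take L", OF measurable_sort_key[OF measurable_nn_dist[OF assms]]]) simp

lemma borel_measurable_sum_list:
  assumes "\<And>i. f i \<in> borel_measurable \<Omega>"
  shows "(\<lambda>\<omega>. \<Sum>i\<leftarrow>l. f i \<omega> :: real) \<in> borel_measurable \<Omega>"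
  using assms by (induction l) simp_all

text \<open>Data and query point may both depend on \<open>\<omega>\<close>, which serves the later
  integrals over either of them. The neighbour and selection lists take countably many values, so
  each sum is first treated for a fixed list.\<close>

lemma measurable_selective_knn:
  assumes dst: "\<And>i. (\<lambda>\<omega>. dist (X \<omega>) (fst (D \<omega> i))) \<in> borel_measurable \<Omega>"
    and lab: "\<And>i. (\<lambda>\<omega>. snd (D \<omega> i)) \<in> measurable \<Omega> (count_space UNIV)"
  shows "Measurable.pred \<Omega> (\<lambda>\<omega>. selective_knn N k M L (D \<omega>) s (X \<omega>))"
proof -
  note [measurable] = lab
  have "(\<lambda>\<omega>. \<Sum>i\<leftarrow>take k l. of_bool (snd (D \<omega> i)) :: real) \<in> borel_measurable \<Omega>" for l
    by (rule borel_measurable_sum_list) measurable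
  note this[THEN measurable_compose_countable, OF measurable_neighbours[OF dst], measurable]
  have "(\<lambda>\<omega>. \<Sum>m\<leftarrow>l. knn_avg k (D \<omega>) (subsample N s m) (X \<omega>)) \<in> borel_measurable \<Omega>" for l
    unfolding knn_avg_def by (rule borel_measurable_sum_list) measurable
  note this[THEN measurable_compose_countable, OF measurable_selected[OF dst], measurable]
  show ?thesis
    unfolding selective_knn_def selective_avg_def by measurable
qed

section \<open>A fixed query point and a fixed split\<close>

locale fixed_query =
  fixes P :: "('a::{metric_space, second_countable_topology} \<times> bool) measure"
    and N M k L :: nat and s :: "nat \<Rightarrow> nat" and x :: 'a
  assumes joint_law: "joint_law P"
    and distinct_dists: "AE D in sample P N. inj_on (\<lambda>i. dist x (fst (D i))) {..<N}"
    and s: "s \<in> splits N M"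
    and k: "1 \<le> k" "k + 1 \<le> N div M"
    and L: "L \<le> M"
begin

abbreviation "dst D i \<equiv> dist x (fst (D i))"
abbreviation "block m \<equiv> subsample N s m"
abbreviation "chosen D \<equiv> set (selected N k M L D s x)"

text \<open>Lists are indexed from 0, so position \<open>k\<close> holds the
  \<open>(k + 1)\<close>-st neighbour, whose distance \<open>nn_dist (k + 1)\<close> ranks the
  block.\<close>

definition pivot :: "(nat \<Rightarrow> 'a \<times> bool) \<Rightarrow> nat \<Rightarrow> nat" where
  "pivot D m = neighbours D (block m) x ! k"

definition near :: "(nat \<Rightarrow> 'a \<times> bool) \<Rightarrow> nat \<Rightarrow> nat set" where
  "near D m = set (take k (neighbours D (block m) x))"

abbreviation "voters D \<equiv> (\<Union>m\<in>chosen D. near D m)"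

sublocale P: prob_space P
  using joint_law by (simp add: joint_law_def)

sublocale sample: prob_space "sample P N"
  unfolding sample_def by (intro prob_space_PiM P.prob_space_axioms)

lemma events: "Measurable.pred P Q \<Longrightarrow> {z. Q z} \<in> sets P"
  using joint_law_space[OF joint_law] by (simp add: pred_def)

lemma block_finite [simp]: "finite (block m)"
  and block_subset: "block m \<subseteq> {..<N}"
  and block_iff: "i \<in> block m \<longleftrightarrow> i < N \<and> s i = m"
  and card_block: "m < M \<Longrightarrow> card (block m) = N div M"
  using s by (auto simp: subsample_def splits_def)

lemma neighbours_block:
  "set (neighbours D (block m) x) = block m"
  "distinct (neighbours D (block m) x)"
  "m < M \<Longrightarrow> length (neighbours D (block m) x) = N div M"
  by (auto simp: neighbours_def card_block)

lemma near_subset: "near D m \<subseteq> block m"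
  unfolding near_def using set_take_subset neighbours_block(1) by metis

lemma card_near: "m < M \<Longrightarrow> card (near D m) = k"
  unfolding near_def using k neighbours_block
  by (subst distinct_card) auto

lemma pivot_block: "m < M \<Longrightarrow> pivot D m \<in> block m"
  unfolding pivot_def using k neighbours_block nth_mem
  by (metis Suc_eq_plus1 Suc_le_lessD)

lemma chosen_eq: "chosen D = set (take L (sort_key (\<lambda>m. dst D (pivot D m)) [0..<M]))"
  by (simp add: selected_def nn_dist_def pivot_def)

lemma chosen_subset: "chosen D \<subseteq> {..<M}"
  unfolding chosen_eq by (auto dest: in_set_takeD)

lemma distinct_selected: "distinct (selected N k M L D s x)"
  by (simp add: selected_def)

lemma card_chosen: "card (chosen D) = L"
  using L by (subst distinct_card) (auto simp: selected_def)

lemma finite_near: "finite (near D m)"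
  by (simp add: near_def)

lemma near_disjoint:
  assumes "m \<noteq> m'"
  shows "near D m \<inter> near D m' = {}"
proof -
  have "s i = m" if "i \<in> near D m" for i m
    using that near_subset[of D m] block_iff by blast
  then show ?thesis using assms by blast
qed

lemma card_voters: "card (voters D) = k * L"
proof -
  have "card (voters D) = (\<Sum>m\<in>chosen D. card (near D m))"
    by (intro card_UN_disjoint) (simp_all add: near_disjoint finite_near)
  also have "\<dots> = k * L" using chosen_subset[of D] by (simp add: card_near card_chosen subset_iff)
  finally show ?thesis .
qed

text \<open>Comparison with the pivot replaces sorting. In this form the voters of a block can be
  integrated out independently once the pivot is fixed.\<close>

lemma near_eq:
  assumes "inj_on (dst D) {..<N}" "m < M"
  shows "near D m = {i \<in> block m. dst D i < dst D (pivot D m)}"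
proof -
  have "near D m = {i \<in> set (sorted_list_of_set (block m)).
      dst D i < dst D (sort_key (dst D) (sorted_list_of_set (block m)) ! k)}"
    unfolding near_def neighbours_def
  proof (rule set_take_sort_key)
    show "inj_on (dst D) (set (sorted_list_of_set (block m)))"
      using assms(1) by (rule inj_on_subset) (use block_subset in simp)
    show "k < length (sorted_list_of_set (block m))"
      using k assms(2) by (simp add: card_block)
  qed simp
  then show ?thesis by (simp add: pivot_def neighbours_def)
qed

text \<open>
  A configuration records the selected blocks, the \<open>(k + 1)\<close>-st neighbour (pivot) in each block, and the
  set of the \<open>k\<close> nearest neighbours in each block. Once the configuration and all sample points other
  than the voters are fixed, the voters of a selected block are independent draws from \<open>P\<close>
  conditioned on being closer to \<open>x\<close> than the pivot of the block.
\<close>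

definition configs :: "(nat set \<times> (nat \<Rightarrow> nat) \<times> (nat \<Rightarrow> nat set)) set" where
  "configs = {(T, j, V) \<in> Pow {..<M} \<times> ({..<M} \<rightarrow>\<^sub>E {..<N}) \<times> ({..<M} \<rightarrow>\<^sub>E Pow {..<N}).
     card T = L \<and> (\<forall>m<M. j m \<in> block m - V m \<and> V m \<subseteq> block m \<and> card (V m) = k)}"

definition config :: "(nat \<Rightarrow> 'a \<times> bool) \<Rightarrow> nat set \<times> (nat \<Rightarrow> nat) \<times> (nat \<Rightarrow> nat set)" where
  "config D = (chosen D, restrict (pivot D) {..<M}, restrict (near D) {..<M})"

text \<open>Only comparisons of distances occur, with pivots that are prescribed instead of
  computed. So the event is visibly measurable, and its conditions on the voters of the selected
  blocks separate into one for each voter.\<close>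

definition agrees :: "nat set \<times> (nat \<Rightarrow> nat) \<times> (nat \<Rightarrow> nat set) \<Rightarrow> (nat \<Rightarrow> 'a \<times> bool) \<Rightarrow> bool" where
  "agrees = (\<lambda>(T, j, V) D. (\<forall>m<M. \<forall>i\<in>block m. dst D i < dst D (j m) \<longleftrightarrow> i \<in> V m) \<and>
     set (take L (sort_key (\<lambda>m. dst D (j m)) [0..<M])) = T)"

lemma finite_configs: "finite configs"
  unfolding configs_def
  by (rule finite_subset[where B="Pow {..<M} \<times> ({..<M} \<rightarrow>\<^sub>E {..<N}) \<times> ({..<M} \<rightarrow>\<^sub>E Pow {..<N})"])
     (auto intro!: finite_cartesian_product finite_PiE)

lemma config_in_configs:
  assumes "inj_on (dst D) {..<N}"
  shows "config D \<in> configs"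
proof -
  have "pivot D m \<notin> near D m" if "m < M" for m
    using near_eq[OF assms that] by simp
  moreover have "pivot D m \<in> {..<N}" if "m < M" for m
    using pivot_block[OF that] block_subset by auto
  moreover have "near D m \<in> Pow {..<N}" for m
    using near_subset block_subset by blast
  ultimately show ?thesis
    using near_subset pivot_block chosen_subset card_chosen card_near
    unfolding configs_def config_def by auto
qed

text \<open>If \<open>D\<close> agrees with \<open>c\<close>, exactly \<open>k\<close> points of
  block \<open>m\<close> are closer than \<open>j m\<close>. The true pivot has the same rank, so
  the two coincide in the absence of ties; the neighbours and the selection then coincide as
  well.\<close>

lemma agrees_iff:
  assumes inj: "inj_on (dst D) {..<N}" and c: "c \<in> configs"
  shows "agrees c D \<longleftrightarrow> config D = c"
proof -
  obtain T j V where c_eq: "c = (T, j, V)" by (cases c)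
  have c': "T \<subseteq> {..<M}" "j \<in> {..<M} \<rightarrow>\<^sub>E {..<N}" "V \<in> {..<M} \<rightarrow>\<^sub>E Pow {..<N}"
    "\<And>m. m < M \<Longrightarrow> j m \<in> block m \<and> V m \<subseteq> block m \<and> card (V m) = k"
    using c by (auto simp: configs_def c_eq)
  have sk: "sort_key (\<lambda>m. dst D (j m)) [0..<M] = sort_key (\<lambda>m. dst D (pivot D m)) [0..<M]"
    if "\<And>m. m < M \<Longrightarrow> pivot D m = j m"
    using that by (intro sort_key_cong) auto
  show ?thesis
  proof
    assume "config D = c"
    then have *: "chosen D = T" "restrict (pivot D) {..<M} = j" "restrict (near D) {..<M} = V"
      by (auto simp: config_def c_eq)
    then have "pivot D m = j m" "near D m = V m" if "m < M" for m
      using that by auto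
    with *(1) near_eq[OF inj] sk show "agrees c D"
      by (auto simp: agrees_def c_eq chosen_eq)
  next
    assume "agrees c D"
    then have a: "\<And>m i. m < M \<Longrightarrow> i \<in> block m \<Longrightarrow> dst D i < dst D (j m) \<longleftrightarrow> i \<in> V m"
      and T: "set (take L (sort_key (\<lambda>m. dst D (j m)) [0..<M])) = T"
      by (auto simp: agrees_def c_eq)
    have V: "V m = {i \<in> block m. dst D i < dst D (j m)}" if "m < M" for m
      using a[OF that] c'(4)[OF that] by blast
    have p: "pivot D m = j m" if "m < M" for m
    proof (rule eq_if_card_less_eq)
      show "inj_on (dst D) (block m)" using inj block_subset by (rule inj_on_subset)
      show "card {i \<in> block m. dst D i < dst D (pivot D m)} = card {i \<in> block m. dst D i < dst D (j m)}"
        using V[OF that] c'(4)[OF that] near_eq[OF inj that] card_near[OF that] by metis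
    qed (use that c'(4) pivot_block in auto)
    have n: "near D m = V m" if "m < M" for m
      using V near_eq[OF inj] p that by simp
    have "chosen D = T"
      using T sk[OF p] by (simp add: chosen_eq)
    moreover have "restrict (pivot D) {..<M} = j"
      using c'(2) p by (auto simp: restrict_def PiE_def extensional_def fun_eq_iff)
    moreover have "restrict (near D) {..<M} = V"
      using c'(3) n by (auto simp: restrict_def PiE_def extensional_def fun_eq_iff)
    ultimately show "config D = c" by (simp add: config_def c_eq)
  qed
qed

section \<open>Integration over the configurations\<close>

lemma measurable_dst: "(\<lambda>D. dst D i) \<in> borel_measurable (Pi\<^sub>M I (\<lambda>_. P))"
  by (rule measurable_compose[OF measurable_PiM_component joint_law_measurable(3)])
     (auto simp: joint_law_space joint_law)

lemma measurable_order: "Measurable.pred (Pi\<^sub>M I (\<lambda>_. P)) (\<lambda>D. set (take L (sort_key (\<lambda>m. dst D (j m)) xs)) = T)"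
  for xs :: "nat list"
proof -
  have "(\<lambda>D. sort_key (\<lambda>m. dst D (j m)) xs) \<in> measurable (Pi\<^sub>M I (\<lambda>_. P)) (count_space UNIV)"
    by (rule measurable_sort_key) (rule measurable_dst)
  then show ?thesis
    by (rule measurable_compose) simp
qed

text \<open>An instance of \<open>nn_integral_pivot_le\<close>: \<open>K\<close> consists of the
  voters of the selected blocks, and voter \<open>i\<close> is compared with the pivot
  \<open>j (s i)\<close> of its own block. Since the pivots are required to lie within
  \<open>r\<close>, the factor \<open>q\<close> only has to be justified for radii up to
  \<open>r\<close>.\<close>

lemma nn_integral_config_le:
  fixes w :: "'a \<times> bool \<Rightarrow> ennreal"
  assumes c: "(T, j, V) \<in> configs"
    and w: "w \<in> borel_measurable P"
    and q: "\<And>u. u \<le> r \<Longrightarrow>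
      (\<integral>\<^sup>+z. w z * indicator {z. dist x (fst z) < u} z \<partial>P) \<le> q * (\<integral>\<^sup>+z. indicator {z. dist x (fst z) < u} z \<partial>P)"
  shows "(\<integral>\<^sup>+D. indicator {D. agrees (T, j, V) D \<and> (\<forall>m\<in>T. dst D (j m) \<le> r)} D * (\<Prod>i\<in>(\<Union>m\<in>T. V m). w (D i)) \<partial>sample P N)
    \<le> q ^ (k * L) * (\<integral>\<^sup>+D. indicator {D. agrees (T, j, V) D \<and> (\<forall>m\<in>T. dst D (j m) \<le> r)} D \<partial>sample P N)"
proof -
  have T: "T \<subseteq> {..<M}" "card T = L"
    and jV: "\<And>m. m < M \<Longrightarrow> j m \<in> block m" "\<And>m. m < M \<Longrightarrow> j m \<notin> V m"
      "\<And>m. m < M \<Longrightarrow> V m \<subseteq> block m" "\<And>m. m < M \<Longrightarrow> card (V m) = k"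
    using c by (auto simp: configs_def)
  define K where "K = (\<Union>m\<in>T. V m)"
  define J where "J = {..<N} - K"
  \<comment> \<open>An index belongs to a single block, so it can be a voter only through that
    block.\<close>
  have K_iff: "i \<in> K \<longleftrightarrow> s i \<in> T \<and> i \<in> V (s i)" for i
    using jV(3) T unfolding K_def by (force simp: block_iff)
  have K_sub: "K \<subseteq> {..<N}"
    using jV(3) T block_subset unfolding K_def by blast
  then have fin: "finite K" "finite J" "J \<inter> K = {}" and un: "J \<union> K = {..<N}"
    by (auto simp: J_def intro: finite_subset)
  have jJ: "j m \<in> J" if "m < M" for m
    using jV(1,2)[OF that] that by (auto simp: J_def K_iff block_iff)
  have card_K: "card K = k * L"
  proof -
    have "card K = (\<Sum>m\<in>T. card (V m))"
      unfolding K_def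
    proof (rule card_UN_disjoint)
      show "finite T" using T finite_subset by blast
      show "\<forall>m\<in>T. finite (V m)" using jV(3) T block_finite finite_subset by (metis lessThan_iff subsetD)
      have "s i = m" if "m \<in> T" "i \<in> V m" for i m
        using that jV(3)[of m] T(1) by (auto simp: block_iff subset_iff)
      then show "\<forall>m\<in>T. \<forall>m'\<in>T. m \<noteq> m' \<longrightarrow> V m \<inter> V m' = {}"
        by blast
    qed
    also have "\<dots> = k * L" using jV(4) T by (simp add: subset_iff)
    finally show ?thesis .
  qed
  \<comment> \<open>The part of the event that involves no voter of a selected block. The sets
    \<open>V m\<close> of blocks outside \<open>T\<close> are disjoint from \<open>K\<close>, so
    their comparisons stay here.\<close>
  define G where "G y \<longleftrightarrow> (\<forall>m\<in>{..<M}. \<forall>i\<in>block m - K. dst y i < dst y (j m) \<longleftrightarrow> i \<in> V m) \<and>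
     set (take L (sort_key (\<lambda>m. dst y (j m)) [0..<M])) = T \<and> (\<forall>m\<in>T. dst y (j m) \<le> r)" for y :: "nat \<Rightarrow> 'a \<times> bool"
  have finT: "finite T" using T finite_subset by blast
  have [measurable]: "Measurable.pred (Pi\<^sub>M J (\<lambda>_. P)) G"
  proof -
    note [measurable] = measurable_dst measurable_order
    show ?thesis unfolding G_def
      using finT by (intro pred_intros_logic pred_intros_finite) (auto, measurable)
  qed
  have E: "{D. agrees (T, j, V) D \<and> (\<forall>m\<in>T. dst D (j m) \<le> r)}
     = {D. G (restrict D J) \<and> (\<forall>i\<in>K. dst D i < dst D (j (s i)))}"
  proof -
    have "agrees (T, j, V) D \<and> (\<forall>m\<in>T. dst D (j m) \<le> r) \<longleftrightarrow>
       G (restrict D J) \<and> (\<forall>i\<in>K. dst D i < dst D (j (s i)))" for D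
    proof -
      have r: "restrict D J (j m) = D (j m)" if "m < M" for m using jJ[OF that] by simp
      have r2: "restrict D J i = D i" if "i \<in> block m - K" for i m
        using that block_subset by (auto simp: J_def)
      have sk: "sort_key (\<lambda>m. dst (restrict D J) (j m)) [0..<M] = sort_key (\<lambda>m. dst D (j m)) [0..<M]"
        by (intro sort_key_cong) (simp add: jJ)
      have "(\<forall>m<M. \<forall>i\<in>block m. dst D i < dst D (j m) \<longleftrightarrow> i \<in> V m) \<longleftrightarrow>
         (\<forall>m\<in>{..<M}. \<forall>i\<in>block m - K. dst D i < dst D (j m) \<longleftrightarrow> i \<in> V m) \<and> (\<forall>i\<in>K. dst D i < dst D (j (s i)))"
        (is "?all \<longleftrightarrow> ?out \<and> ?ins")
      proof
        assume *: ?all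
        moreover have "s i < M \<and> i \<in> block (s i) \<and> i \<in> V (s i)" if "i \<in> K" for i
          using that T K_sub by (auto simp: K_iff block_iff)
        ultimately show "?out \<and> ?ins" by auto
      next
        assume *: "?out \<and> ?ins"
        have "dst D i < dst D (j m) \<longleftrightarrow> i \<in> V m" if "m < M" "i \<in> block m" for m i
        proof (cases "i \<in> K")
          case True
          moreover have "s i = m" using that by (simp add: block_iff)
          ultimately show ?thesis using * K_iff[of i] by auto
        qed (use * that in auto)
        then show ?all by blast
      qed
      moreover have "(\<forall>m\<in>{..<M}. \<forall>i\<in>block m - K. dst (restrict D J) i < dst (restrict D J) (j m) \<longleftrightarrow> i \<in> V m)
         \<longleftrightarrow> (\<forall>m\<in>{..<M}. \<forall>i\<in>block m - K. dst D i < dst D (j m) \<longleftrightarrow> i \<in> V m)"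
        using r r2 by (intro ball_cong refl) (metis lessThan_iff)
      moreover have "(\<forall>m\<in>T. dst (restrict D J) (j m) \<le> r) \<longleftrightarrow> (\<forall>m\<in>T. dst D (j m) \<le> r)"
        using r T by (intro ball_cong refl) (metis lessThan_iff subsetD)
      ultimately show ?thesis
        unfolding agrees_def G_def sk by (simp only: prod.case) blast
    qed
    then show ?thesis by blast
  qed
  show ?thesis
    unfolding E sample_def un[symmetric] card_K[symmetric] K_def[symmetric]
  proof (rule nn_integral_pivot_le)
    show "j (s i) \<in> J" if "i \<in> K" for i
      using that T jJ by (auto simp: K_iff)
    show "(\<integral>\<^sup>+z. w z * indicator {z. dist x (fst z) < dist x (fst (y (j (s i))))} z \<partial>P)
       \<le> q * (\<integral>\<^sup>+z. indicator {z. dist x (fst z) < dist x (fst (y (j (s i))))} z \<partial>P)"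
      if "G y" "i \<in> K" for y i
      using that by (intro q) (auto simp: G_def K_iff)
  qed (use fin w joint_law_measurable(3)[OF joint_law] in \<open>auto intro: P.prob_space_axioms\<close>)
qed

text \<open>The configuration events are disjoint up to a null set. Their probabilities add up to at
  most 1, so summing the bounds over all configurations costs no factor for their number.\<close>

lemma nn_integral_voters_le:
  fixes w :: "'a \<times> bool \<Rightarrow> ennreal"
  assumes w: "w \<in> borel_measurable P"
    and q: "\<And>u. u \<le> r \<Longrightarrow>
      (\<integral>\<^sup>+z. w z * indicator {z. dist x (fst z) < u} z \<partial>P) \<le> q * (\<integral>\<^sup>+z. indicator {z. dist x (fst z) < u} z \<partial>P)"
  shows "(\<integral>\<^sup>+D. indicator {D. \<forall>m\<in>chosen D. dst D (pivot D m) \<le> r} D * (\<Prod>i\<in>voters D. w (D i)) \<partial>sample P N)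
    \<le> q ^ (k * L)"
proof -
  define E where "E = (\<lambda>(T, j, V). {D. agrees (T, j, V) D \<and> (\<forall>m\<in>T. dst D (j m) \<le> r)})"
  define W where "W = (\<lambda>(T :: nat set, j :: nat \<Rightarrow> nat, V :: nat \<Rightarrow> nat set) D. \<Prod>i\<in>(\<Union>m\<in>T. V m). w (D i))"
  define F where "F D = (indicator {D. \<forall>m\<in>chosen D. dst D (pivot D m) \<le> r} D * (\<Prod>i\<in>voters D. w (D i)) :: ennreal)" for D
  have E_meas[measurable]: "(indicator (E c) :: _ \<Rightarrow> ennreal) \<in> borel_measurable (sample P N)" if "c \<in> configs" for c
  proof -
    obtain T j V where c: "c = (T, j, V)" by (cases c)
    have T: "finite T" using that finite_subset by (auto simp: c configs_def)
    have "Measurable.pred (sample P N) (\<lambda>D. (\<forall>m\<in>{..<M}. \<forall>i\<in>block m. dst D i < dst D (j m) \<longleftrightarrow> i \<in> V m) \<and>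
      set (take L (sort_key (\<lambda>m. dst D (j m)) [0..<M])) = T \<and> (\<forall>m\<in>T. dst D (j m) \<le> r))"
      (is "Measurable.pred _ ?Q")
    proof -
      note [measurable] = measurable_dst measurable_order
      show ?thesis unfolding sample_def
        using T by (intro pred_intros_logic pred_intros_finite) (auto, measurable)
    qed
    moreover have "indicator (E c) = (\<lambda>D. of_bool (?Q D) :: ennreal)"
      by (auto simp: E_def c agrees_def indicator_def fun_eq_iff)
    moreover from \<open>Measurable.pred _ ?Q\<close> have "(\<lambda>D. of_bool (?Q D) :: ennreal) \<in> borel_measurable (sample P N)"
      by (rule measurable_compose) simp
    ultimately show ?thesis by simp
  qed
  have W_meas[measurable]: "W c \<in> borel_measurable (sample P N)" for c
    unfolding W_def case_prod_beta sample_def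
    using w joint_law_space[OF joint_law]
    by (intro borel_measurable_prod_ennreal measurable_compose[OF measurable_PiM_component w]) auto
  have part: "AE D in sample P N. \<forall>c\<in>configs. D \<in> E c \<longrightarrow> c = config D"
    using distinct_dists by eventually_elim (auto simp: E_def agrees_iff)
  \<comment> \<open>Almost surely \<open>D\<close> lies in the event of its own configuration, and
    that term alone equals \<open>F D\<close>.\<close>
  have "AE D in sample P N. F D \<le> (\<Sum>c\<in>configs. indicator (E c) D * W c D)"
    using distinct_dists
  proof eventually_elim
    case (elim D)
    note inj = this
    have "agrees (config D) D" using agrees_iff[OF inj config_in_configs[OF inj]] by simp
    then have "F D = indicator (E (config D)) D * W (config D) D"
      using chosen_subset[of D]
      by (auto simp: F_def E_def W_def config_def indicator_def subset_iff intro!: prod.cong)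
    also have "\<dots> \<le> (\<Sum>c\<in>configs. indicator (E c) D * W c D)"
      using config_in_configs[OF inj] finite_configs by (intro member_le_sum) auto
    finally show ?case .
  qed
  then have "(\<integral>\<^sup>+D. F D \<partial>sample P N) \<le> (\<integral>\<^sup>+D. (\<Sum>c\<in>configs. indicator (E c) D * W c D) \<partial>sample P N)"
    by (rule nn_integral_mono_AE)
  also have "\<dots> = (\<Sum>c\<in>configs. \<integral>\<^sup>+D. indicator (E c) D * W c D \<partial>sample P N)"
    by (rule nn_integral_sum) measurable
  also have "\<dots> \<le> (\<Sum>c\<in>configs. q ^ (k * L) * (\<integral>\<^sup>+D. indicator (E c) D \<partial>sample P N))"
  proof (rule sum_mono)
    fix c assume c: "c \<in> configs"
    obtain T j V where "c = (T, j, V)" by (cases c)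
    then show "(\<integral>\<^sup>+D. indicator (E c) D * W c D \<partial>sample P N) \<le> q ^ (k * L) * (\<integral>\<^sup>+D. indicator (E c) D \<partial>sample P N)"
      using nn_integral_config_le[OF _ w q, of T j V r] c by (simp add: E_def W_def)
  qed
  also have "\<dots> = q ^ (k * L) * (\<integral>\<^sup>+D. (\<Sum>c\<in>configs. indicator (E c) D) \<partial>sample P N)"
    by (subst nn_integral_sum) (auto simp: sum_distrib_left)
  also have "(\<integral>\<^sup>+D. (\<Sum>c\<in>configs. indicator (E c) D) \<partial>sample P N) \<le> (\<integral>\<^sup>+D. 1 \<partial>sample P N)"
  proof (rule nn_integral_mono_AE)
    show "AE D in sample P N. (\<Sum>c\<in>configs. indicator (E c) D) \<le> (1::ennreal)"
      using part
    proof eventually_elim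
      case (elim D)
      then have "(\<Sum>c\<in>configs. indicator (E c) D) \<le> (\<Sum>c\<in>configs. if c = config D then 1 else 0 :: ennreal)"
        by (intro sum_mono) (auto simp: indicator_def)
      also have "\<dots> \<le> 1" using finite_configs by simp
      finally show ?case .
    qed
  qed
  also have "(\<integral>\<^sup>+D. 1 \<partial>sample P N) = 1" by (simp add: sample.emeasure_space_1)
  finally show ?thesis by (simp add: F_def mult_left_mono)
qed

text \<open>
  Chernoff's bound with the multiplier \<open>1 + \<Delta>/2\<close>; its optimal value would only improve the constant.
\<close>

lemma prob_wrong_vote:
  assumes \<Delta>: "0 \<le> \<Delta>" "\<Delta> \<le> 1"
    and b: "\<And>u. u \<le> r \<Longrightarrow> measure P {z. snd z = b \<and> dist x (fst z) < u} \<le> (1/2 - \<Delta>/2) * measure P {z. dist x (fst z) < u}"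
  shows "(\<integral>\<^sup>+D. indicator {D. (\<forall>m\<in>chosen D. dst D (pivot D m) \<le> r) \<and>
      k * L \<le> 2 * card {i \<in> voters D. snd (D i) = b}} D \<partial>sample P N) \<le> ennreal (exp (- \<Delta>\<^sup>2 * real (k * L) / 4))"
proof -
  define \<epsilon> where "\<epsilon> = \<Delta> / 2"
  have \<epsilon>: "0 \<le> \<epsilon>" "\<Delta> = 2 * \<epsilon>" using \<Delta> by (auto simp: \<epsilon>_def)
  note [measurable] = joint_law_measurable[OF joint_law]
  \<comment> \<open>A vote for the wrong label \<open>b\<close> weighs
    \<open>1 + \<epsilon>\<close>, a correct vote the reciprocal. The product of the weights is at
    least 1 as soon as \<open>b\<close> gets half of the votes, ties included.\<close>
  define w where "w z = (if snd z = b then 1 + \<epsilon> else 1 / (1 + \<epsilon>))" for z :: "'a \<times> bool"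
  have w0: "0 \<le> w z" for z using \<epsilon> by (auto simp: w_def)
  have one_le: "1 \<le> (\<Prod>i\<in>voters D. ennreal (w (D i)))" if "k * L \<le> 2 * card {i \<in> voters D. snd (D i) = b}" for D
  proof -
    let ?V = "voters D" and ?Yes = "{i \<in> voters D. snd (D i) = b}" and ?No = "{i \<in> voters D. snd (D i) \<noteq> b}"
    have fin: "finite ?V" by (simp add: finite_near)
    have "card ?V \<le> 2 * card ?Yes" unfolding card_voters by fact
    moreover have "card ?V = card ?Yes + card ?No"
      using fin by (subst card_Un_disjoint[symmetric]) (force intro!: arg_cong[where f=card])+
    ultimately have c: "card ?No \<le> card ?Yes" by simp
    have "(\<Prod>i\<in>?V. w (D i)) = (\<Prod>i\<in>?Yes. w (D i)) * (\<Prod>i\<in>?No. w (D i))"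
      using fin by (subst prod.union_disjoint[symmetric]) (auto intro!: prod.cong)
    also have "\<dots> = (1 + \<epsilon>) ^ card ?Yes * (1 / (1 + \<epsilon>)) ^ card ?No"
      by (simp add: w_def)
    also have "\<dots> = (1 + \<epsilon>) ^ (card ?Yes - card ?No)"
      using c \<epsilon> by (simp add: power_diff power_divide)
    also have "\<dots> \<ge> 1" using \<epsilon> by simp
    finally show ?thesis using w0 by (simp add: prod_ennreal)
  qed
  have q: "(\<integral>\<^sup>+z. ennreal (w z) * indicator {z. dist x (fst z) < u} z \<partial>P) \<le>
      ennreal (1 - \<Delta>\<^sup>2 / 4) * (\<integral>\<^sup>+z. indicator {z. dist x (fst z) < u} z \<partial>P)" if u: "u \<le> r" for u
  proof -
    let ?p = "measure P {z. dist x (fst z) < u}" and ?h = "measure P {z. snd z = b \<and> dist x (fst z) < u}"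
    have sets[measurable]: "{z. dist x (fst z) < u} \<in> sets P""{z. snd z = b \<and> dist x (fst z) < u} \<in> sets P"
      by (intro events; measurable)+
    define S0 where "S0 = {z. dist x (fst z) < u} - {z. snd z = b \<and> dist x (fst z) < u}"
    have [measurable]: "S0 \<in> sets P" unfolding S0_def by measurable
    have h0: "measure P S0 = ?p - ?h"
      unfolding S0_def by (rule P.finite_measure_Diff) auto
    have "(\<integral>\<^sup>+z. ennreal (w z) * indicator {z. dist x (fst z) < u} z \<partial>P)
       = (\<integral>\<^sup>+z. ennreal (1 + \<epsilon>) * indicator {z. snd z = b \<and> dist x (fst z) < u} z
           + ennreal (1 / (1 + \<epsilon>)) * indicator S0 z \<partial>P)"
      by (intro nn_integral_cong) (auto simp: w_def S0_def indicator_def)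
    also have "\<dots> = ennreal (1 + \<epsilon>) * ?h + ennreal (1 / (1 + \<epsilon>)) * measure P S0"
      by (subst nn_integral_add) (auto simp: nn_integral_cmult P.emeasure_eq_measure)
    also have "\<dots> = ennreal ((1 + \<epsilon>) * ?h + (1 / (1 + \<epsilon>)) * measure P S0)"
    proof -
      have "ennreal a * ennreal c + ennreal d * ennreal e = ennreal (a * c + d * e)"
        if "0 \<le> a" "0 \<le> c" "0 \<le> d" "0 \<le> e" for a c d e
        using that by (simp add: ennreal_mult)
      then show ?thesis by this (use \<epsilon>(1) in simp_all)
    qed
    also have "\<dots> = ennreal ((1 + \<epsilon>) * ?h + (1 / (1 + \<epsilon>)) * (?p - ?h))"
      by (simp only: h0)
    also have "\<dots> \<le> ennreal ((1 - \<Delta>\<^sup>2 / 4) * ?p)"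
    proof (rule ennreal_leI)
      \<comment> \<open>This holds because \<open>(1 + \<epsilon>) * (1 - \<epsilon> +
        \<epsilon>\<^sup>2) = 1 + \<epsilon> ^ 3\<close>. As label \<open>b\<close> has a share of
        at most \<open>1/2 - \<epsilon>\<close> in the ball, the mean weight there is at most
        \<open>1 - \<epsilon> + \<epsilon>\<^sup>2 + 2 * \<epsilon> * (1/2 - \<epsilon>) = 1 -
        \<epsilon>\<^sup>2\<close>.\<close>
      have "1 / (1 + \<epsilon>) \<le> 1 - \<epsilon> + \<epsilon>\<^sup>2"
        using \<epsilon>(1) by (simp add: divide_le_eq) (simp add: algebra_simps power2_eq_square)
      then have "(1 / (1 + \<epsilon>)) * (?p - ?h) \<le> (1 - \<epsilon> + \<epsilon>\<^sup>2) * (?p - ?h)"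
        by (intro mult_right_mono) (auto simp flip: h0)
      then have "(1 + \<epsilon>) * ?h + (1 / (1 + \<epsilon>)) * (?p - ?h) \<le> (1 - \<epsilon> + \<epsilon>\<^sup>2) * ?p + (2 * \<epsilon> - \<epsilon>\<^sup>2) * ?h"
        by (simp add: algebra_simps)
      also have "(2 * \<epsilon> - \<epsilon>\<^sup>2) * ?h \<le> 2 * \<epsilon> * ?h" by (intro mult_right_mono) auto
      also have "2 * \<epsilon> * ?h \<le> 2 * \<epsilon> * ((1/2 - \<Delta>/2) * ?p)"
        using b[OF u] \<epsilon>(1) by (intro mult_left_mono) auto
      also have "(1 - \<epsilon> + \<epsilon>\<^sup>2) * ?p + 2 * \<epsilon> * ((1/2 - \<Delta>/2) * ?p) = (1 - \<Delta>\<^sup>2 / 4) * ?p"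
        unfolding \<epsilon>(2) by (simp add: algebra_simps power2_eq_square)
      finally show "(1 + \<epsilon>) * ?h + (1 / (1 + \<epsilon>)) * (?p - ?h) \<le> (1 - \<Delta>\<^sup>2 / 4) * ?p" by simp
    qed
    also have "\<dots> = ennreal (1 - \<Delta>\<^sup>2 / 4) * (\<integral>\<^sup>+z. indicator {z. dist x (fst z) < u} z \<partial>P)"
      using power_le_one[OF \<Delta>, of 2] by (simp add: P.emeasure_eq_measure ennreal_mult)
    finally show ?thesis .
  qed
  have "(\<integral>\<^sup>+D. indicator {D. (\<forall>m\<in>chosen D. dst D (pivot D m) \<le> r) \<and>
      k * L \<le> 2 * card {i \<in> voters D. snd (D i) = b}} D \<partial>sample P N)
    \<le> (\<integral>\<^sup>+D. indicator {D. \<forall>m\<in>chosen D. dst D (pivot D m) \<le> r} D * (\<Prod>i\<in>voters D. ennreal (w (D i))) \<partial>sample P N)"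
    using one_le by (intro nn_integral_mono) (auto simp: indicator_def)
  also have "\<dots> \<le> ennreal (1 - \<Delta>\<^sup>2 / 4) ^ (k * L)"
    by (rule nn_integral_voters_le[OF _ q]) (simp_all add: w_def)
  also have "\<dots> \<le> ennreal (exp (- \<Delta>\<^sup>2 / 4)) ^ (k * L)"
    using exp_ge_add_one_self[of "- \<Delta>\<^sup>2 / 4"] by (intro power_mono ennreal_leI) auto
  also have "\<dots> = ennreal (exp (- \<Delta>\<^sup>2 * real (k * L) / 4))"
    by (simp add: ennreal_power exp_of_nat_mult[symmetric] mult_ac)
  finally show ?thesis .
qed


section \<open>Location of the selected pivots\<close>

lemma measurable_pivot_dst: "(\<lambda>D. dst D (pivot D m)) \<in> borel_measurable (sample P N)"
  using measurable_nn_dist[OF measurable_dst, where k="k + 1" and I="block m"]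
  by (simp add: nn_dist_def pivot_def sample_def)

lemma measurable_pivots_le: "Measurable.pred (sample P N) (\<lambda>D. \<forall>m\<in>chosen D. dst D (pivot D m) \<le> r)"
proof (rule measurable_compose_countable[where f="\<lambda>l D. \<forall>m\<in>set l. dst D (pivot D m) \<le> r"])
  note [measurable] = measurable_pivot_dst
  show "Measurable.pred (sample P N) (\<lambda>D. \<forall>m\<in>set l. dst D (pivot D m) \<le> r)" for l
    by (intro pred_intros_finite) (auto, measurable)
  show "(\<lambda>D. selected N k M L D s x) \<in> measurable (sample P N) (count_space UNIV)"
    unfolding sample_def by (rule measurable_selected[OF measurable_dst])
qed

lemma sets_sparse_blocks:
  assumes "finite T"
  shows "{D \<in> space (sample P N). \<forall>m\<in>T. card {i \<in> block m. dst D i \<le> r} \<le> k} \<in> sets (sample P N)"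
proof -
  note [measurable] = measurable_dst
  have "Measurable.pred (sample P N) (\<lambda>D. card {i \<in> block m. dst D i \<le> r} \<le> k)" for m
    unfolding sample_def by measurable
  then show ?thesis
    by (intro predE pred_intros_finite(3) assms)
qed

text \<open>
  Markov's inequality for \<open>2\<close> to the power \<open>k |T|\<close> minus the number of sample points in the ball.
\<close>

lemma prob_sparse_blocks:
  assumes p: "measure P {z. dist x (fst z) \<le> r} = p" and np: "8 * real k \<le> p * real (N div M)"
    and T: "T \<subseteq> {..<M}"
  shows "emeasure (sample P N) {D \<in> space (sample P N). \<forall>m\<in>T. card {i \<in> block m. dst D i \<le> r} \<le> k}
    \<le> ennreal (exp (- 3 * real k * real (card T)))"
proof -
  note [measurable] = joint_law_measurable[OF joint_law] measurable_dst
  interpret product_sigma_finite "\<lambda>_::nat. P" by standard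
  \<comment> \<open>Each sample point of a block in \<open>T\<close> that falls into the ball
    contributes \<open>1/2\<close>, every other point 1. The product over the sample is
    \<open>1/2\<close> to the power of the count, and the factors are independent.\<close>
  define v where "v i z = (1 - indicator {z. s i \<in> T \<and> dist x (fst z) \<le> r} z / 2 :: real)" for i and z :: "'a \<times> bool"
  have v_meas[measurable]: "v i \<in> borel_measurable P" for i
    unfolding v_def by measurable
  have v: "1 / 2 \<le> v i z" "v i z \<le> 1" for i z by (auto simp: v_def indicator_def)
  have v0: "0 \<le> v i z" for i z using v(1)[of i z] by linarith
  have finT: "finite T" using T finite_subset by blast
  let ?I = "{i. i < N \<and> s i \<in> T}"
  have cardI: "card ?I = N div M * card T"
  proof -
    have "?I = (\<Union>m\<in>T. block m)" by (auto simp: block_iff)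
    also have "card \<dots> = (\<Sum>m\<in>T. card (block m))"
      using finT by (intro card_UN_disjoint) (auto simp: block_iff)
    also have "\<dots> = (\<Sum>m\<in>T. N div M)"
      using T card_block by (intro sum.cong) auto
    finally show ?thesis by simp
  qed
  have p01: "0 \<le> p" "p \<le> 1" using p by auto
  have int_v: "(\<integral>\<^sup>+z. ennreal (v i z) \<partial>P) = ennreal (if s i \<in> T then 1 - p / 2 else 1)" for i
  proof -
    have int: "integrable P (v i)"
      using v0 v(2) by (intro P.integrable_const_bound[where B=1]) (auto intro!: AE_I2)
    have "(\<integral>\<^sup>+z. ennreal (v i z) \<partial>P) = ennreal (\<integral>z. v i z \<partial>P)"
      using int v0 by (intro nn_integral_eq_integral) auto
    also have "(\<integral>z. v i z \<partial>P) = (if s i \<in> T then 1 - p / 2 else 1)"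
    proof (cases "s i \<in> T")
      case True
      have set: "{z. dist x (fst z) \<le> r} \<in> sets P" by (intro events) measurable
      have "(\<integral>z. v i z \<partial>P) = (\<integral>z. 1 - indicator {z. dist x (fst z) \<le> r} z / 2 \<partial>P)"
        by (simp add: v_def True)
      also have "\<dots> = 1 - p / 2"
        using set p by (subst Bochner_Integration.integral_diff)
          (auto simp: P.prob_space less_top[symmetric] intro!: Bochner_Integration.integrable_divide_zero integrable_real_indicator)
      finally show ?thesis using True by simp
    qed (simp add: v_def P.prob_space)
    finally show ?thesis .
  qed
  let ?B = "{D \<in> space (sample P N). \<forall>m\<in>T. card {i \<in> block m. dst D i \<le> r} \<le> k}"
  have "emeasure (sample P N) ?B \<le> (\<integral>\<^sup>+D. 2 ^ (k * card T) * (\<Prod>i<N. ennreal (v i (D i))) \<partial>sample P N)"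
  proof -
    have B_meas: "?B \<in> sets (sample P N)"
      using finT by (rule sets_sparse_blocks)
    then have "emeasure (sample P N) ?B = (\<integral>\<^sup>+D. indicator ?B D \<partial>sample P N)"
      by (rule nn_integral_indicator[symmetric])
    also have "\<dots> \<le> (\<integral>\<^sup>+D. 2 ^ (k * card T) * (\<Prod>i<N. ennreal (v i (D i))) \<partial>sample P N)"
    proof (intro nn_integral_mono)
      fix D
      show "indicator ?B D \<le> (2 ^ (k * card T) * (\<Prod>i<N. ennreal (v i (D i))) :: ennreal)"
      proof (cases "D \<in> ?B")
        case True
        let ?C = "{i. i < N \<and> s i \<in> T \<and> dst D i \<le> r}"
        have C: "?C = (\<Union>m\<in>T. {i \<in> block m. dst D i \<le> r})" by (auto simp: block_iff)
        have "card ?C \<le> (\<Sum>m\<in>T. card {i \<in> block m. dst D i \<le> r})"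
          unfolding C using finT by (rule card_UN_le)
        also have "\<dots> \<le> (\<Sum>m\<in>T. k)" using True by (intro sum_mono) auto
        finally have c: "card ?C \<le> k * card T" by (simp add: mult.commute)
        have "(\<Prod>i<N. v i (D i)) = (\<Prod>i\<in>?C. 1 / 2)"
          by (rule prod.mono_neutral_cong_right) (auto simp: v_def)
        also have "\<dots> = (1 / 2) ^ card ?C" by simp
        also have "\<dots> \<ge> (1 / 2) ^ (k * card T)" using c by (intro power_decreasing) auto
        finally have "1 \<le> 2 ^ (k * card T) * (\<Prod>i<N. v i (D i))"
          by (simp add: power_divide field_simps)
        then have "1 \<le> ennreal (2 ^ (k * card T) * (\<Prod>i<N. v i (D i)))" by simp
        also have "\<dots> = 2 ^ (k * card T) * (\<Prod>i<N. ennreal (v i (D i)))"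
          using v0 by (simp add: ennreal_mult' prod_ennreal flip: ennreal_power)
        finally show ?thesis using True by simp
      qed simp
    qed
    finally show ?thesis .
  qed
  also have "\<dots> = 2 ^ (k * card T) * (\<Prod>i<N. \<integral>\<^sup>+z. ennreal (v i z) \<partial>P)"
    unfolding sample_def
  proof (subst nn_integral_cmult)
    show "(\<lambda>D. \<Prod>i<N. ennreal (v i (D i))) \<in> borel_measurable (Pi\<^sub>M {..<N} (\<lambda>i. P))"
      by (intro borel_measurable_prod_ennreal) measurable
  qed (subst product_nn_integral_prod, auto)
  also have "(\<Prod>i<N. \<integral>\<^sup>+z. ennreal (v i z) \<partial>P) = ennreal ((1 - p / 2) ^ (N div M * card T))"
  proof -
    have "(\<Prod>i<N. if s i \<in> T then 1 - p / 2 else 1) = (\<Prod>i\<in>?I. 1 - p / 2)"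
      by (rule prod.mono_neutral_cong_right) auto
    then show ?thesis
      using p01 by (simp add: int_v prod_ennreal cardI)
  qed
  also have "2 ^ (k * card T) * ennreal ((1 - p / 2) ^ (N div M * card T))
     = ennreal (2 ^ (k * card T) * (1 - p / 2) ^ (N div M * card T))"
    by (simp add: ennreal_mult' flip: ennreal_power)
  also have "\<dots> \<le> ennreal (exp (- 3 * real k * real (card T)))"
  proof (rule ennreal_leI)
    \<comment> \<open>With \<open>2 \<le> exp 1\<close>, the first factor costs \<open>k |T|\<close>
      in the exponent. The second gains \<open>p n |T| / 2\<close> with \<open>n = N div M\<close>,
      which is at least \<open>4 k |T|\<close> by \<open>np\<close>; so \<open>3 k |T|\<close> is
      left.\<close>
    have "(2::real) ^ (k * card T) \<le> exp 1 ^ (k * card T)"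
      using exp_ge_add_one_self[of 1] by (intro power_mono) auto
    also have "\<dots> = exp (real k * real (card T))" by (simp flip: exp_of_nat_mult)
    finally have 1: "(2::real) ^ (k * card T) \<le> exp (real k * real (card T))" .
    have "(1 - p / 2) ^ (N div M * card T) \<le> exp (- p / 2) ^ (N div M * card T)"
      using p01 exp_ge_add_one_self[of "- p / 2"] by (intro power_mono) auto
    also have "\<dots> = exp (- ((p * real (N div M)) / 2 * real (card T)))"
      by (simp flip: exp_of_nat_mult add: mult_ac)
    also have "\<dots> \<le> exp (- (4 * real k * real (card T)))"
      using mult_right_mono[OF np, of "real (card T)"] by simp
    finally have 2: "(1 - p / 2) ^ (N div M * card T) \<le> exp (- (4 * real k * real (card T)))" .
    have "2 ^ (k * card T) * (1 - p / 2) ^ (N div M * card T) \<le>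
        exp (real k * real (card T)) * exp (- (4 * real k * real (card T)))"
      using 1 2 p01 by (intro mult_mono) auto
    also have "\<dots> = exp (- 3 * real k * real (card T))"
      by (simp flip: exp_add)
    finally show "2 ^ (k * card T) * (1 - p / 2) ^ (N div M * card T) \<le> exp (- 3 * real k * real (card T))" .
  qed
  finally show ?thesis .
qed

text \<open>
  If one selected pivot lies outside the ball, so do the pivots of all blocks that were not
  selected; these are at least half of the blocks, and each has at most \<open>k\<close> points in the ball.
\<close>

lemma prob_far_pivot:
  assumes p: "measure P {z. dist x (fst z) \<le> r} = p" and np: "8 * real k \<le> p * real (N div M)"
    and LM: "2 * L \<le> M + 1"
  shows "emeasure (sample P N) {D \<in> space (sample P N). \<not> (\<forall>m\<in>chosen D. dst D (pivot D m) \<le> r)}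
    \<le> ennreal (exp (- real (k * M) / 2))"
proof -
  define B where "B T = {D \<in> space (sample P N). \<forall>m\<in>T. card {i \<in> block m. dst D i \<le> r} \<le> k}" for T
  \<comment> \<open>The set of blocks with far pivots is random. The union bound therefore runs over
    all sets containing at least half of the blocks.\<close>
  define TT where "TT = {T. T \<subseteq> {..<M} \<and> M \<le> 2 * card T}"
  have finTT: "finite TT" "card TT \<le> 2 ^ M"
  proof -
    have sub: "TT \<subseteq> Pow {..<M}" by (auto simp: TT_def)
    show "finite TT" using sub finite_subset by blast
    show "card TT \<le> 2 ^ M" using card_mono[OF _ sub] by (simp add: card_Pow)
  qed
  have B_meas: "B T \<in> sets (sample P N)" if "T \<in> TT" for T
    using that finite_subset[of T "{..<M}"] unfolding B_def TT_def by (intro sets_sparse_blocks) auto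
  have "AE D in sample P N. D \<in> {D \<in> space (sample P N). \<not> (\<forall>m\<in>chosen D. dst D (pivot D m) \<le> r)} \<longrightarrow> D \<in> (\<Union>T\<in>TT. B T)"
    using distinct_dists
  proof eventually_elim
    case inj: (elim D)
    show ?case
    proof
      assume D: "D \<in> {D \<in> space (sample P N). \<not> (\<forall>m\<in>chosen D. dst D (pivot D m) \<le> r)}"
      then obtain m where m: "m \<in> chosen D" "r < dst D (pivot D m)" by auto
      define T where "T = {m. m < M \<and> r < dst D (pivot D m)}"
      have sub: "insert m ({..<M} - chosen D) \<subseteq> T"
      proof (rule insert_subsetI)
        show "m \<in> T" using m chosen_subset[of D] by (auto simp: T_def)
        show "{..<M} - chosen D \<subseteq> T"
        proof
          fix m' assume m': "m' \<in> {..<M} - chosen D"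
          then have "dst D (pivot D m) \<le> dst D (pivot D m')"
            using m(1) by (intro sort_key_take_le[of m L "\<lambda>m. dst D (pivot D m)" "[0..<M]"]) (simp_all only: chosen_eq, auto)
          then show "m' \<in> T" using m(2) m' by (simp add: T_def)
        qed
      qed
      \<comment> \<open>One selected block and all \<open>M - L\<close> unselected ones. From
        \<open>2 * L \<le> M + 1\<close>, twice this number is at least
        \<open>M + 1\<close>.\<close>
      have "M - L + 1 = card (insert m ({..<M} - chosen D))"
        using m(1) chosen_subset[of D] by (simp add: card_Diff_subset card_chosen)
      also have "\<dots> \<le> card T" using sub by (intro card_mono) (auto simp: T_def)
      finally have "T \<in> TT" using LM by (auto simp: TT_def T_def)
      moreover have "D \<in> B T"
      proof -
        have "card {i \<in> block m. dst D i \<le> r} \<le> k" if "m \<in> T" for m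
        proof -
          have "m < M" "r < dst D (pivot D m)" using that by (auto simp: T_def)
          then have "{i \<in> block m. dst D i \<le> r} \<subseteq> near D m" using near_eq[OF inj] by auto
          then have "card {i \<in> block m. dst D i \<le> r} \<le> card (near D m)"
            by (intro card_mono) (auto simp: near_def)
          then show ?thesis using card_near \<open>m < M\<close> by simp
        qed
        then show ?thesis using D by (simp add: B_def)
      qed
      ultimately show "D \<in> (\<Union>T\<in>TT. B T)" by blast
    qed
  qed
  then have "emeasure (sample P N) {D \<in> space (sample P N). \<not> (\<forall>m\<in>chosen D. dst D (pivot D m) \<le> r)}
     \<le> emeasure (sample P N) (\<Union>T\<in>TT. B T)"
    using finTT B_meas by (intro emeasure_mono_AE) auto
  also have "\<dots> \<le> (\<Sum>T\<in>TT. emeasure (sample P N) (B T))"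
    using finTT B_meas by (intro emeasure_subadditive_finite) auto
  also have "\<dots> \<le> (\<Sum>T\<in>TT. ennreal (exp (- 3 / 2 * real (k * M))))"
  proof (rule sum_mono)
    fix T assume T: "T \<in> TT"
    then have "real M \<le> 2 * real (card T)" by (auto simp: TT_def)
    then have "3 / 2 * real k * real M \<le> 3 / 2 * real k * (2 * real (card T))"
      by (intro mult_left_mono) auto
    then have "ennreal (exp (- 3 * real k * real (card T))) \<le> ennreal (exp (- 3 / 2 * real (k * M)))"
      by (intro ennreal_leI) simp
    then show "emeasure (sample P N) (B T) \<le> ennreal (exp (- 3 / 2 * real (k * M)))"
      using order_trans[OF prob_sparse_blocks[OF p np, of T]] T unfolding B_def TT_def by blast
  qed
  also have "\<dots> = ennreal (real (card TT) * exp (- 3 / 2 * real (k * M)))"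
    by (simp add: ennreal_mult' ennreal_of_nat_eq_real_of_nat)
  \<comment> \<open>The union bound costs \<open>2 ^ M\<close>, which is at most
    \<open>exp (k M)\<close> because \<open>1 \<le> k\<close>. Against the decay
    \<open>exp (- 3/2 k M)\<close> of each term this leaves \<open>exp (- k M / 2)\<close>.\<close>
  also have "\<dots> \<le> ennreal (exp (real (k * M)) * exp (- 3 / 2 * real (k * M)))"
  proof (intro ennreal_leI mult_right_mono)
    have "real (card TT) \<le> 2 ^ M" using finTT(2) by (metis of_nat_le_iff of_nat_numeral of_nat_power)
    also have "\<dots> \<le> exp 1 ^ M"
      using exp_ge_add_one_self[of 1] by (intro power_mono) auto
    also have "\<dots> = exp (real M)" by (simp flip: exp_of_nat_mult)
    also have "\<dots> \<le> exp (real (k * M))" using k(1) mult_right_mono[of 1 "real k" "real M"] by simp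
    finally show "real (card TT) \<le> exp (real (k * M))" .
  qed simp
  also have "\<dots> = ennreal (exp (- real (k * M) / 2))" by (simp flip: exp_add)
  finally show ?thesis .
qed

end

subsection \<open>The probability of disagreeing with the Bayes rule\<close>

text \<open>Two independent sample points both lie on the sphere with the square of its probability,
  and then they tie. The absence of ties for sample size 2 makes this square vanish.\<close>

lemma no_ties_sphere:
  fixes P :: "('a::{metric_space, second_countable_topology} \<times> bool) measure"
  assumes P: "joint_law P" and ties: "no_ties P"
  shows "measure P {z. dist x (fst z) = r} = 0"
proof -
  interpret P: prob_space P using P by (simp add: joint_law_def)
  interpret product_sigma_finite "\<lambda>_::nat. P" by standard
  note [measurable] = joint_law_measurable[OF P]
  define E where "E = {z :: 'a \<times> bool. dist x (fst z) = r}"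
  have E: "E \<in> sets P"
  proof -
    have "{z \<in> space P. dist x (fst z) = r} \<in> sets P" by measurable
    then show ?thesis by (simp add: E_def joint_law_space[OF P])
  qed
  have "AE D in sample P 2. D \<notin> Pi\<^sub>E {..<2} (\<lambda>_. E)"
    using ties[unfolded no_ties_def, rule_format, of x 2]
  proof eventually_elim
    case (elim D)
    have "D \<in> Pi\<^sub>E {..<2} (\<lambda>_. E) \<Longrightarrow> dist x (fst (D 0)) = dist x (fst (D 1))"
      by (simp add: E_def PiE_iff)
    then show ?case using inj_onD[OF elim, of 0 1] by auto
  qed
  moreover have box: "Pi\<^sub>E {..<2} (\<lambda>_. E) \<in> sets (sample P 2)"
    unfolding sample_def using E by (intro sets_PiM_I_finite) auto
  ultimately have "emeasure (sample P 2) (Pi\<^sub>E {..<2} (\<lambda>_. E)) = 0"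
    by (intro AE_iff_measurable[THEN iffD1]) (use sets.sets_into_space[OF box] in \<open>auto\<close>)
  also have "emeasure (sample P 2) (Pi\<^sub>E {..<2} (\<lambda>_. E)) = emeasure P E ^ 2"
    unfolding sample_def using E by (subst emeasure_PiM) auto
  finally show ?thesis
    by (simp add: E_def measure_def)
qed

text \<open>Null spheres make the distribution function of the distance to \<open>x\<close>
  continuous, and its limits are 0 and 1; the intermediate value theorem applies.\<close>

lemma exists_radius:
  fixes P :: "('a::{metric_space, second_countable_topology} \<times> bool) measure"
  assumes P: "joint_law P" and sphere: "\<And>r. measure P {z. dist x (fst z) = r} = 0"
    and p: "0 < p" "p < 1"
  shows "\<exists>r. measure P {z. dist x (fst z) \<le> r} = p"
proof -
  interpret P: prob_space P using P by (simp add: joint_law_def)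
  note [measurable] = joint_law_measurable[OF P]
  define Q where "Q = distr P borel (\<lambda>z. dist x (fst z))"
  interpret Q: prob_space Q unfolding Q_def by (rule P.prob_space_distr) measurable
  interpret Q: real_distribution Q by standard (auto simp: Q_def)
  have Q_eq: "measure Q S = measure P {z. dist x (fst z) \<in> S}" if "S \<in> sets borel" for S
    unfolding Q_def using that joint_law_space[OF P] by (subst measure_distr) (auto simp: vimage_def)
  have cont: "isCont (cdf Q) r" for r
    unfolding Q.isCont_cdf using sphere by (simp add: Q_eq)
  have "eventually (\<lambda>r. cdf Q r > p) at_top" "eventually (\<lambda>r. cdf Q r < p) at_bot"
    using Q.cdf_lim_at_top_prob Q.cdf_lim_at_bot p by (auto intro: order_tendstoD)
  then obtain a b where "\<forall>r\<ge>b. cdf Q r > p" "\<forall>r\<le>a. cdf Q r < p"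
    unfolding eventually_at_top_linorder eventually_at_bot_linorder by blast
  then have "\<exists>r\<ge>min a b. r \<le> b \<and> cdf Q r = p"
    using cont by (intro IVT) (auto simp: min_def less_imp_le)
  then show ?thesis by (auto simp: cdf_def Q_eq)
qed

section \<open>Counting the votes\<close>

context fixed_query begin

text \<open>By convention \<open>N div 0 = 0\<close>, which contradicts
  \<open>k + 1 \<le> N div M\<close>.\<close>

lemma M_pos: "0 < M" using k by (cases M) auto

text \<open>Each selected block contributes exactly \<open>k\<close> votes, and blocks share no
  sample index. So the average of the block averages is the plain average over all
  \<open>k * L\<close> voters.\<close>

lemma selective_avg_eq:
  "selective_avg N k M L D s x = real (card {i \<in> voters D. snd (D i)}) / real (k * L)"
proof -
  have knn: "knn_avg k D (block m) x = (\<Sum>i\<in>near D m. of_bool (snd (D i))) / real k" for m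
    unfolding knn_avg_def near_def
    by (subst sum_list_distinct_conv_sum_set) (use neighbours_block in auto)
  have "(\<Sum>m\<leftarrow>selected N k M L D s x. knn_avg k D (block m) x)
      = (\<Sum>m\<in>chosen D. (\<Sum>i\<in>near D m. of_bool (snd (D i))) / real k)"
    by (subst sum_list_distinct_conv_sum_set) (auto simp: distinct_selected knn)
  also have "\<dots> = (\<Sum>i\<in>voters D. of_bool (snd (D i))) / real k"
    by (subst sum.UNION_disjoint) (simp_all add: near_disjoint sum_divide_distrib finite_near)
  also have "(\<Sum>i\<in>voters D. of_bool (snd (D i)) :: real) = real (card {i \<in> voters D. snd (D i)})"
    by (subst sum_of_bool_eq) (auto simp: near_def Int_def)
  finally show ?thesis unfolding selective_avg_def by simp
qed

text \<open>Here \<open>h\<close> stands for \<open>\<eta> x\<close>. An even vote is decided for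
  label 1, so it is an error only if \<open>h < 1/2\<close>; the non-strict inequality covers both
  cases.\<close>

lemma wrong_vote_imp:
  assumes L: "0 < L" and wrong: "selective_knn N k M L D s x \<noteq> (1/2 \<le> h)"
  shows "k * L \<le> 2 * card {i \<in> voters D. snd (D i) = (\<not> 1/2 \<le> h)}"
proof (cases "1/2 \<le> h")
  case True
  then have "real (card {i \<in> voters D. snd (D i)}) / real (k * L) < 1 / 2"
    using wrong by (simp add: selective_knn_def selective_avg_eq)
  then have "2 * card {i \<in> voters D. snd (D i)} < k * L"
    using L k(1) by (simp add: divide_less_eq flip: of_nat_mult)
  moreover have "card {i \<in> voters D. snd (D i)} + card {i \<in> voters D. \<not> snd (D i)} = card (voters D)"
    by (subst card_Un_disjoint[symmetric]) (auto simp: near_def intro!: arg_cong[where f=card])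
  ultimately show ?thesis using True by (simp add: card_voters)
next
  case False
  then have "real (card {i \<in> voters D. snd (D i)}) / real (k * L) \<ge> 1 / 2"
    using wrong by (simp add: selective_knn_def selective_avg_eq)
  then have "2 * card {i \<in> voters D. snd (D i)} \<ge> k * L"
    using L k(1) by (simp add: le_divide_eq flip: of_nat_mult)
  then show ?thesis using False by simp
qed

text \<open>An error requires either a selected pivot outside the ball of mass \<open>p\<close> or a
  wrong majority among voters drawn within it. The first event is \<open>prob_far_pivot\<close>, the
  second \<open>prob_wrong_vote\<close>. The assumption \<open>close\<close> allows the local
  average of the labels to be off by half of the distance from \<open>h\<close> to
  \<open>1/2\<close>.\<close>

lemma prob_vote_ne:
  assumes sphere: "\<And>r. measure P {z. dist x (fst z) = r} = 0"
    and p: "0 < p" "p < 1" and np: "8 * real k \<le> p * real (N div M)"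
    and LM: "2 * L \<le> M + 1" "M \<le> 2 * L"
    and h: "0 \<le> h" "h \<le> 1"
    and close: "\<And>u. 0 < u \<Longrightarrow> measure P {z. dist x (fst z) < u} \<le> p \<Longrightarrow>
      \<bar>measure P {z. snd z \<and> dist x (fst z) < u} - h * measure P {z. dist x (fst z) < u}\<bar>
        \<le> \<bar>h - 1/2\<bar> / 2 * measure P {z. dist x (fst z) < u}"
  shows "emeasure (sample P N) {D \<in> space (sample P N). selective_knn N k M L D s x \<noteq> (1/2 \<le> h)}
    \<le> ennreal (exp (- real (k * M) / 2) + exp (- (real (k * M) / 8 * \<bar>h - 1/2\<bar>\<^sup>2)))"
proof -
  note [measurable] = joint_law_measurable[OF joint_law]
  define \<Delta> where "\<Delta> = \<bar>h - 1/2\<bar>"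
  define b where "b \<longleftrightarrow> \<not> 1/2 \<le> h"
  obtain r where r: "measure P {z. dist x (fst z) \<le> r} = p"
    using exists_radius[OF joint_law sphere p] by blast
  have ball_sets: "{z. dist x (fst z) < u} \<in> sets P" "{z. dist x (fst z) \<le> u} \<in> sets P"
    "{z. snd z \<and> dist x (fst z) < u} \<in> sets P" for u
    by (intro events; measurable)+
  let ?far = "{D \<in> space (sample P N). \<not> (\<forall>m\<in>chosen D. dst D (pivot D m) \<le> r)}"
  let ?wrong = "{D \<in> space (sample P N). selective_knn N k M L D s x \<noteq> (1/2 \<le> h)}"
  have lab: "(\<lambda>D. snd (D i)) \<in> measurable (sample P N) (count_space UNIV)" for i
    unfolding sample_def
    by (rule measurable_compose[OF measurable_PiM_component joint_law_measurable(2)])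
       (auto simp: joint_law_space joint_law)
  have [measurable]: "Measurable.pred (sample P N) (\<lambda>D. selective_knn N k M L D s x)"
    using measurable_dst lab unfolding sample_def by (intro measurable_selective_knn)
  note [measurable] = measurable_pivots_le
  have sets: "?far \<in> sets (sample P N)" "?wrong \<in> sets (sample P N)" by measurable
  \<comment> \<open>The share of the wrong label is \<open>1/2 - \<Delta>\<close> when computed from
    \<open>h\<close>, and the local error \<open>\<Delta> / 2\<close> raises it to at most
    \<open>1/2 - \<Delta> / 2\<close>. For \<open>u \<le> 0\<close> the ball is empty.\<close>
  have b_le: "measure P {z. snd z = b \<and> dist x (fst z) < u} \<le> (1/2 - \<Delta>/2) * measure P {z. dist x (fst z) < u}"
    if u: "u \<le> r" for u
  proof (cases "0 < u")
    case True
    let ?p = "measure P {z. dist x (fst z) < u}" and ?h = "measure P {z. snd z \<and> dist x (fst z) < u}"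
    have "?p \<le> p" unfolding r[symmetric] using ball_sets u by (intro P.finite_measure_mono) auto
    from close[OF True this] have c: "\<bar>?h - h * ?p\<bar> \<le> \<Delta> / 2 * ?p" by (simp add: \<Delta>_def)
    show ?thesis
    proof (cases b)
      case True
      then have h: "h = 1/2 - \<Delta>" by (auto simp: b_def \<Delta>_def)
      from c have "?h \<le> (1/2 - \<Delta>) * ?p + \<Delta> / 2 * ?p" unfolding h by linarith
      with True show ?thesis by (simp add: algebra_simps)
    next
      case False
      have "{z. snd z = b \<and> dist x (fst z) < u} = {z. dist x (fst z) < u} - {z. snd z \<and> dist x (fst z) < u}"
        using False by auto
      then have "measure P {z. snd z = b \<and> dist x (fst z) < u} = ?p - ?h"
        using ball_sets by (simp only:, intro P.finite_measure_Diff) auto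
      moreover have h: "h = 1/2 + \<Delta>" using False by (auto simp: b_def \<Delta>_def)
      ultimately have "measure P {z. snd z = b \<and> dist x (fst z) < u} \<le> ?p - ((1/2 + \<Delta>) * ?p - \<Delta> / 2 * ?p)"
        using c[unfolded h] by linarith
      then show ?thesis by (simp add: algebra_simps)
    qed
  next
    case False
    then have "\<not> dist x y < u" for y using zero_le_dist[of x y] by linarith
    then show ?thesis by simp
  qed
  have "emeasure (sample P N) ?wrong \<le> emeasure (sample P N) (?far \<union> (?wrong - ?far))"
    using sets by (intro emeasure_mono) auto
  also have "\<dots> \<le> emeasure (sample P N) ?far + emeasure (sample P N) (?wrong - ?far)"
    using sets by (intro emeasure_subadditive) auto
  also have "emeasure (sample P N) (?wrong - ?far) \<le> ennreal (exp (- \<Delta>\<^sup>2 * real (k * L) / 4))"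
  proof -
    have "emeasure (sample P N) (?wrong - ?far) = (\<integral>\<^sup>+D. indicator (?wrong - ?far) D \<partial>sample P N)"
      using sets.Diff[OF sets(2,1)] by (rule nn_integral_indicator[symmetric])
    also have "\<dots> \<le> (\<integral>\<^sup>+D. indicator {D. (\<forall>m\<in>chosen D. dst D (pivot D m) \<le> r) \<and>
        k * L \<le> 2 * card {i \<in> voters D. snd (D i) = b}} D \<partial>sample P N)"
      using wrong_vote_imp[of _ h] LM(2) M_pos
      by (intro nn_integral_mono) (auto simp: indicator_def b_def)
    also have "\<dots> \<le> ennreal (exp (- \<Delta>\<^sup>2 * real (k * L) / 4))"
      using h by (intro prob_wrong_vote b_le) (auto simp: \<Delta>_def)
    finally show ?thesis .
  qed
  \<comment> \<open>At least half of the blocks vote, so \<open>L\<close> may be replaced by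
    \<open>M / 2\<close>; this is where the constant 8 arises.\<close>
  also have "ennreal (exp (- \<Delta>\<^sup>2 * real (k * L) / 4)) \<le> ennreal (exp (- (real (k * M) / 8 * \<Delta>\<^sup>2)))"
  proof (intro ennreal_leI)
    have "real M \<le> 2 * real L" using LM(2) by linarith
    then have "(\<Delta>\<^sup>2 * real k / 8) * real M \<le> (\<Delta>\<^sup>2 * real k / 8) * (2 * real L)"
      by (intro mult_left_mono) auto
    then show "exp (- \<Delta>\<^sup>2 * real (k * L) / 4) \<le> exp (- (real (k * M) / 8 * \<Delta>\<^sup>2))"
      by (simp add: mult_ac)
  qed
  also have "emeasure (sample P N) ?far \<le> ennreal (exp (- real (k * M) / 2))"
    by (rule prob_far_pivot[OF r np LM(1)])
  finally show ?thesis by (simp add: \<Delta>_def flip: ennreal_plus)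
qed

end

subsection \<open>Peeling\<close>

lemma summable_powr_exp_sq:
  fixes b q :: real
  assumes b: "0 < b"
  shows "summable (\<lambda>j. (real j + 1) powr q * exp (- (b * (real j)\<^sup>2)))"
proof (rule summable_comparison_test_bigo)
  show "summable (\<lambda>j. norm (1 / real j ^ 2))"
    using inverse_power_summable[of 2, where 'a=real] by (simp add: field_simps)
  show "(\<lambda>j. (real j + 1) powr q * exp (- (b * (real j)\<^sup>2))) \<in> O(\<lambda>j. 1 / real j ^ 2)"
    using b by real_asymp
qed

text \<open>
  The domain is cut into the shells \<open>j \<delta> \<le> g x < (j + 1) \<delta>\<close>.
\<close>

lemma nn_integral_peeling:
  fixes g :: "'a \<Rightarrow> real" and f :: "'a \<Rightarrow> ennreal" and n :: nat
  assumes \<mu>: "prob_space \<mu>" and [measurable]: "g \<in> borel_measurable \<mu>"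
    and g: "\<And>x. 0 \<le> g x" "\<And>x. g x \<le> 1"
    and S: "AE x in \<mu>. x \<in> S"
    and margin: "\<And>t. 0 < t \<Longrightarrow> emeasure \<mu> {x \<in> space \<mu>. g x \<le> t} \<le> ennreal (B * t powr \<beta>)"
    and B: "0 \<le> B"
    and \<delta>: "0 < \<delta>" and b: "0 < b" and c: "0 \<le> c"
    and f1: "\<And>x. f x \<le> 1"
    and f: "\<And>x. x \<in> S \<Longrightarrow> \<delta> \<le> g x \<Longrightarrow> f x \<le> ennreal (c + exp (- (b * (g x / \<delta>)\<^sup>2)))"
  shows "(\<integral>\<^sup>+x. ennreal (g x ^ n) * f x \<partial>\<mu>)
    \<le> ennreal (c + B * (\<Sum>j. (real j + 1) powr (real n + \<beta>) * exp (- (b * (real j)\<^sup>2))) * \<delta> powr (real n + \<beta>))"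
proof -
  interpret \<mu>: prob_space \<mu> by fact
  define a where "a j = ((real j + 1) * \<delta>) ^ n * exp (- (b * (real j)\<^sup>2))" for j :: nat
  have a0: "0 \<le> a j" for j using \<delta> by (simp add: a_def)
  \<comment> \<open>A whole sublevel set instead of the shell, since this is what
    \<open>margin\<close> bounds. At each point only the term of its own shell is needed.\<close>
  define A where "A j = {x \<in> space \<mu>. g x \<le> (real j + 1) * \<delta>}" for j :: nat
  have [measurable]: "A j \<in> sets \<mu>" for j unfolding A_def by measurable
  let ?h = "\<lambda>j. (real j + 1) powr (real n + \<beta>) * exp (- (b * (real j)\<^sup>2))"
  have "(\<integral>\<^sup>+x. ennreal (g x ^ n) * f x \<partial>\<mu>) \<le> (\<integral>\<^sup>+x. ennreal c + (\<Sum>j. ennreal (a j) * indicator (A j) x) \<partial>\<mu>)"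
  proof (rule nn_integral_mono_AE)
    show "AE x in \<mu>. ennreal (g x ^ n) * f x \<le> ennreal c + (\<Sum>j. ennreal (a j) * indicator (A j) x)"
      using S AE_space
    proof eventually_elim
      case (elim x)
      define j where "j = nat \<lfloor>g x / \<delta>\<rfloor>"
      have "0 \<le> g x / \<delta>" using g \<delta> by simp
      then have j: "real j \<le> g x / \<delta>" "g x / \<delta> < real j + 1"
        by (auto simp: j_def)
      have "ennreal (g x ^ n) * f x \<le> ennreal c + ennreal (g x ^ n * exp (- (b * (real j)\<^sup>2)))"
      proof (cases "j = 0")
        case True
        \<comment> \<open>In the innermost shell only \<open>f x \<le> 1\<close> is available. That
          suffices because the exponential equals 1 at \<open>j = 0\<close>.\<close>
        have "ennreal (g x ^ n) * f x \<le> ennreal (g x ^ n) * 1" using f1 by (intro mult_left_mono) auto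
        then show ?thesis using True by (simp add: add_increasing)
      next
        case False
        then have "1 \<le> g x / \<delta>" using j(1) by linarith
        then have "\<delta> \<le> g x" using \<delta> by (simp add: field_simps)
        then have "ennreal (g x ^ n) * f x \<le> ennreal (g x ^ n) * ennreal (c + exp (- (b * (g x / \<delta>)\<^sup>2)))"
          using f elim by (intro mult_left_mono) auto
        also have "\<dots> = ennreal (g x ^ n * (c + exp (- (b * (g x / \<delta>)\<^sup>2))))"
          using g by (simp add: ennreal_mult')
        also have "\<dots> \<le> ennreal (c + g x ^ n * exp (- (b * (real j)\<^sup>2)))"
        proof (rule ennreal_leI)
          have "g x ^ n * c \<le> 1 * c" using g c by (intro mult_right_mono power_le_one) auto
          moreover have "g x ^ n * exp (- (b * (g x / \<delta>)\<^sup>2)) \<le> g x ^ n * exp (- (b * (real j)\<^sup>2))"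
            using g b j(1) by (intro mult_left_mono) (auto intro!: mult_left_mono power_mono)
          ultimately show "g x ^ n * (c + exp (- (b * (g x / \<delta>)\<^sup>2))) \<le> c + g x ^ n * exp (- (b * (real j)\<^sup>2))"
            by (simp add: distrib_left)
        qed
        also have "\<dots> = ennreal c + ennreal (g x ^ n * exp (- (b * (real j)\<^sup>2)))"
          using g c by (intro ennreal_plus) auto
        finally show ?thesis .
      qed
      also have "ennreal (g x ^ n * exp (- (b * (real j)\<^sup>2))) \<le> ennreal (a j) * indicator (A j) x"
      proof -
        have le: "g x \<le> (real j + 1) * \<delta>" using j(2) \<delta> by (simp add: field_simps)
        then have "x \<in> A j" using elim by (simp add: A_def)
        moreover have "g x ^ n * exp (- (b * (real j)\<^sup>2)) \<le> a j"
          unfolding a_def using g le by (intro mult_right_mono power_mono) auto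
        ultimately show ?thesis by (simp add: ennreal_leI)
      qed
      also have "ennreal (a j) * indicator (A j) x \<le> (\<Sum>j. ennreal (a j) * indicator (A j) x)"
      proof -
        have "F j \<le> suminf F" for F :: "nat \<Rightarrow> ennreal"
          using sum_le_suminf[of F "{j}"] by simp
        then show ?thesis .
      qed
      finally show ?case by (simp add: add_left_mono)
    qed
  qed
  also have "\<dots> = ennreal c + (\<Sum>j. ennreal (a j) * emeasure \<mu> (A j))"
    by (subst nn_integral_add) (auto simp: nn_integral_suminf nn_integral_cmult \<mu>.emeasure_space_1)
  also have "(\<Sum>j. ennreal (a j) * emeasure \<mu> (A j)) \<le> (\<Sum>j. ennreal (B * \<delta> powr (real n + \<beta>) * ?h j))"
  proof (intro suminf_le)
    fix j :: nat
    have "ennreal (a j) * emeasure \<mu> (A j) \<le> ennreal (a j) * ennreal (B * ((real j + 1) * \<delta>) powr \<beta>)"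
      unfolding A_def using \<delta> by (intro mult_left_mono margin) auto
    also have "\<dots> = ennreal (a j * (B * ((real j + 1) * \<delta>) powr \<beta>))"
      using a0 by (simp add: ennreal_mult')
    also have "a j * (B * ((real j + 1) * \<delta>) powr \<beta>) = B * \<delta> powr (real n + \<beta>) * ?h j"
      using \<delta> by (simp add: a_def powr_add powr_realpow powr_mult power_mult_distrib mult_ac)
    finally show "ennreal (a j) * emeasure \<mu> (A j) \<le> ennreal (B * \<delta> powr (real n + \<beta>) * ?h j)" .
  qed auto
  also have "(\<Sum>j. ennreal (B * \<delta> powr (real n + \<beta>) * ?h j)) = ennreal (\<Sum>j. B * \<delta> powr (real n + \<beta>) * ?h j)"
    using B summable_powr_exp_sq[OF b] by (intro suminf_ennreal2 summable_mult) auto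
  also have "(\<Sum>j. B * \<delta> powr (real n + \<beta>) * ?h j) = B * \<delta> powr (real n + \<beta>) * (\<Sum>j. ?h j)"
    by (rule suminf_mult) (rule summable_powr_exp_sq[OF b])
  also have "ennreal c + ennreal (B * \<delta> powr (real n + \<beta>) * (\<Sum>j. ?h j)) = ennreal (c + B * \<delta> powr (real n + \<beta>) * (\<Sum>j. ?h j))"
    using c B summable_powr_exp_sq[OF b, of "real n + \<beta>"]
    by (intro ennreal_plus[symmetric] mult_nonneg_nonneg suminf_nonneg) auto
  finally show ?thesis by (simp add: mult_ac add_left_mono)
qed

subsection \<open>Risk and random splits\<close>

lemma splits_nonempty:
  assumes "M dvd N" "0 < M"
  shows "splits N M \<noteq> {}"
proof -
  obtain n where N: "N = M * n" using assms(1) by (auto elim: dvdE)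
  \<comment> \<open>The witness cuts the sample into consecutive intervals of length
    \<open>n\<close>. For \<open>n = 0\<close> the sample is empty.\<close>
  have "(\<lambda>i\<in>{..<N}. i div n) \<in> splits N M"
  proof -
    have "card {i. i < N \<and> (\<lambda>i\<in>{..<N}. i div n) i = m} = n" if "m < M" for m
    proof (cases "n = 0")
      case False
      have "i < N \<and> i div n = m \<longleftrightarrow> i \<in> {m * n..<m * n + n}" for i
      proof
        assume "i \<in> {m * n..<m * n + n}"
        moreover have "m * n + n \<le> N" using that mult_le_mono1[of "Suc m" M n] by (simp add: N)
        moreover have "i div n = m" if "m * n \<le> i" "i < m * n + n"
          using that by (intro div_nat_eqI) (simp_all add: mult.commute)
        ultimately show "i < N \<and> i div n = m" by simp
      next
        assume "i < N \<and> i div n = m"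
        then have "m * n + i mod n = i" using div_mult_mod_eq[of i n] by simp
        moreover have "i mod n < n" using False by simp
        ultimately show "i \<in> {m * n..<m * n + n}" by simp
      qed
      then have "{i. i < N \<and> i div n = m} = {m * n..<m * n + n}"
        by blast
      moreover have "{i. i < N \<and> (\<lambda>i\<in>{..<N}. i div n) i = m} = {i. i < N \<and> i div n = m}"
        by auto
      ultimately show ?thesis by simp
    qed (simp add: N)
    moreover have "i div n < M" if "i < N" for i
      using that by (simp add: N less_mult_imp_div_less)
    ultimately show ?thesis
      using assms(2) by (auto simp: splits_def N)
  qed
  then show ?thesis by blast
qed

lemma finite_splits: "finite (splits N M)"
  by (rule finite_subset[of _ "{..<N} \<rightarrow>\<^sub>E {..<M}"]) (auto simp: splits_def intro!: finite_PiE)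

lemma prob_space_random_split:
  assumes "M dvd N" "0 < M"
  shows "prob_space (random_split N M)"
  unfolding random_split_def
  using finite_splits splits_nonempty[OF assms] by (rule prob_space_uniform_count_measure)

lemma measurable_random_split: "(\<lambda>s. s) \<in> measurable (random_split N M) (count_space (splits N M))"
  by (simp add: measurable_def random_split_def uniform_count_measure_def space_point_measure)

lemma sets_marginal: "sets (marginal P) = sets borel" "space (marginal P) = UNIV"
  by (auto simp: marginal_def)

lemma prob_space_marginal: "joint_law P \<Longrightarrow> prob_space (marginal P)"
  unfolding marginal_def
  by (intro prob_space.prob_space_distr) (auto simp: joint_law_def intro: joint_law_measurable)

lemma measure_marginal:
  assumes "joint_law P" "A \<in> sets borel"
  shows "measure (marginal P) A = measure P {z. fst z \<in> A}"
  unfolding marginal_def using joint_law_measurable(1)[OF assms(1)] joint_law_space[OF assms(1)] assms(2)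
  by (subst measure_distr) (auto simp: vimage_def)

text \<open>The split takes finitely many values, so the case of a fixed split extends to a random
  one.\<close>

lemma measurable_selective_knn_joint:
  fixes P :: "('a::{metric_space, second_countable_topology} \<times> bool) measure"
  assumes P: "joint_law P"
    and D: "D \<in> measurable \<Omega> (sample P N)" and X: "X \<in> measurable \<Omega> borel"
    and S: "S \<in> measurable \<Omega> (random_split N M)"
  shows "Measurable.pred \<Omega> (\<lambda>\<omega>. selective_knn N k M L (D \<omega>) (S \<omega>) (X \<omega>))"
proof -
  note [measurable] = D X joint_law_measurable[OF P]
  have [measurable]: "(\<lambda>\<omega>. D \<omega> i) \<in> measurable \<Omega> P" for i
    by (rule measurable_compose[OF D[unfolded sample_def] measurable_PiM_component]) (rule joint_law_space[OF P])
  show ?thesis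
  proof (rule measurable_compose_countable'[where g=S and I="splits N M"])
    show "Measurable.pred \<Omega> (\<lambda>\<omega>. selective_knn N k M L (D \<omega>) s (X \<omega>))" for s
      by (rule measurable_selective_knn) measurable
    show "S \<in> measurable \<Omega> (count_space (splits N M))"
      using measurable_compose[OF S measurable_random_split] .
    show "countable (splits N M)" using finite_splits by (rule countable_finite)
  qed
qed

text \<open>The event that the first projection lies in \<open>A\<close> belongs to the conditioning
  sigma-algebra. There the conditional expectation integrates like the label itself, and the result
  is carried over to the marginal.\<close>

lemma regression_set:
  fixes P :: "('a::{metric_space, second_countable_topology} \<times> bool) measure"
  assumes P: "joint_law P" and \<eta>: "regression_function P \<eta>" and A: "A \<in> sets borel"
  shows "measure P {z. fst z \<in> A \<and> snd z} = (\<integral>x. indicator A x * \<eta> x \<partial>marginal P)"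
proof -
  interpret P: prob_space P using P by (simp add: joint_law_def)
  note [measurable] = joint_law_measurable[OF P]
  have \<eta>_meas[measurable]: "\<eta> \<in> borel_measurable borel" using \<eta> by (simp add: regression_function_def)
  let ?F = "vimage_algebra (space P) fst borel"
  have sub: "subalgebra P ?F"
    unfolding subalgebra_def
    by (auto simp: sets_vimage_algebra2 intro!: measurable_sets[OF joint_law_measurable(1)[OF P]])
  interpret F: finite_measure_subalgebra P ?F
    by standard (rule sub)
  let ?A = "{z \<in> space P. fst z \<in> A}"
  have AF: "?A \<in> sets ?F"
    using A by (auto simp: sets_vimage_algebra2 intro!: exI[of _ A])
  have [measurable]: "?A \<in> sets P" using A by measurable
  have int: "integrable P (\<lambda>z. of_bool (snd z) :: real)"
    by (intro P.integrable_const_bound[where B=1]) auto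
  have "measure P {z. fst z \<in> A \<and> snd z} = (\<integral>z. indicator {z. fst z \<in> A \<and> snd z} z \<partial>P)"
    by (simp add: joint_law_space[OF P])
  also have "\<dots> = (\<integral>z\<in>?A. of_bool (snd z) \<partial>P)"
    unfolding set_lebesgue_integral_def
    by (intro Bochner_Integration.integral_cong) (auto simp: indicator_def)
  also have "\<dots> = (\<integral>z\<in>?A. real_cond_exp P ?F (\<lambda>z. of_bool (snd z)) z \<partial>P)"
    by (rule F.real_cond_exp_intA[OF int AF])
  also have "\<dots> = (\<integral>z. indicator A (fst z) * \<eta> (fst z) \<partial>P)"
    unfolding set_lebesgue_integral_def
  proof (rule integral_cong_AE)
    show "AE z in P. indicator ?A z *\<^sub>R real_cond_exp P ?F (\<lambda>z. of_bool (snd z)) z = indicator A (fst z) * \<eta> (fst z)"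
      using \<eta>[unfolded regression_function_def, THEN conjunct2, THEN conjunct2] AE_space
      by eventually_elim (auto simp: indicator_def)
  qed (use A in measurable)
  also have "\<dots> = (\<integral>x. indicator A x * \<eta> x \<partial>marginal P)"
    unfolding marginal_def using A by (subst integral_distr) auto
  finally show ?thesis .
qed

text \<open>Errors are label 0 on the set \<open>G\<close> and label 1 off it. Since
  \<open>regression_set\<close> gives the probabilities of label 1, label 0 enters as a complement
  within \<open>G\<close>.\<close>

lemma risk_eq:
  fixes P :: "('a::{metric_space, second_countable_topology} \<times> bool) measure"
  assumes P: "joint_law P" and \<eta>: "regression_function P \<eta>" and g: "Measurable.pred borel g"
  shows "risk P g = (\<integral>x. (if g x then 1 - \<eta> x else \<eta> x) \<partial>marginal P)"
proof -
  interpret P: prob_space P using P by (simp add: joint_law_def)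
  interpret \<mu>: prob_space "marginal P" using P by (rule prob_space_marginal)
  note [measurable] = joint_law_measurable[OF P] g
  note [measurable_cong] = sets_marginal(1)[of P]
  have \<eta>_meas[measurable]: "\<eta> \<in> borel_measurable borel" and \<eta>01: "0 \<le> \<eta> x" "\<eta> x \<le> 1" for x
    using \<eta> by (auto simp: regression_function_def)
  define G where "G = {x. g x}"
  have G[measurable]: "G \<in> sets borel" unfolding G_def using g by (simp add: pred_def)
  have int: "integrable (marginal P) (\<lambda>x. indicator A x * \<eta> x)" if [measurable]: "A \<in> sets borel" for A
    using \<eta>01 by (intro \<mu>.integrable_const_bound[where B=1]) (auto simp: indicator_def)
  have ev: "{z. fst z \<in> G} \<in> sets P" "{z. fst z \<in> G \<and> snd z} \<in> sets P" "{z. fst z \<in> - G \<and> snd z} \<in> sets P"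
  proof -
    have "{z \<in> space P. fst z \<in> G} \<in> sets P" "{z \<in> space P. fst z \<in> G \<and> snd z} \<in> sets P"
      "{z \<in> space P. fst z \<in> - G \<and> snd z} \<in> sets P" by measurable
    then show "{z. fst z \<in> G} \<in> sets P" "{z. fst z \<in> G \<and> snd z} \<in> sets P" "{z. fst z \<in> - G \<and> snd z} \<in> sets P"
      by (simp_all add: joint_law_space[OF P])
  qed
  have "risk P g = measure P (({z. fst z \<in> G} - {z. fst z \<in> G \<and> snd z}) \<union> {z. fst z \<in> - G \<and> snd z})"
    unfolding risk_def by (intro arg_cong[where f="measure P"]) (auto simp: G_def joint_law_space[OF P])
  also have "\<dots> = measure P ({z. fst z \<in> G} - {z. fst z \<in> G \<and> snd z}) + measure P {z. fst z \<in> - G \<and> snd z}"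
    using ev by (intro P.finite_measure_Union) auto
  also have "measure P ({z. fst z \<in> G} - {z. fst z \<in> G \<and> snd z}) = measure P {z. fst z \<in> G} - measure P {z. fst z \<in> G \<and> snd z}"
    using ev by (intro P.finite_measure_Diff) auto
  also have "measure P {z. fst z \<in> G} = (\<integral>x. indicator G x \<partial>marginal P)"
    using measure_marginal[OF P G] by (simp add: sets_marginal)
  also have "(\<integral>x. indicator G x \<partial>marginal P) - measure P {z. fst z \<in> G \<and> snd z} + measure P {z. fst z \<in> - G \<and> snd z}
      = (\<integral>x. indicator G x - indicator G x * \<eta> x + indicator (- G) x * \<eta> x \<partial>marginal P)"
  proof -
    have "integrable (marginal P) (indicator G :: _ \<Rightarrow> real)"
      by (intro integrable_real_indicator) (auto simp: less_top[symmetric] sets_marginal)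
    moreover have "integrable (marginal P) (\<lambda>x. indicator G x * \<eta> x)" "integrable (marginal P) (\<lambda>x. indicator (- G) x * \<eta> x)"
      by (intro int; measurable)+
    ultimately show ?thesis
      by (simp only: regression_set[OF P \<eta>] G borel_comp Bochner_Integration.integral_add
          Bochner_Integration.integral_diff Bochner_Integration.integrable_diff)
  qed
  also have "\<dots> = (\<integral>x. (if g x then 1 - \<eta> x else \<eta> x) \<partial>marginal P)"
    by (intro Bochner_Integration.integral_cong) (auto simp: G_def)
  finally show ?thesis .
qed

text \<open>Where the classifiers disagree, their conditional risks are \<open>\<eta> x\<close> and
  \<open>1 - \<eta> x\<close>, and the Bayes rule has the smaller one. The gap is twice the distance
  of \<open>\<eta> x\<close> from \<open>1/2\<close>.\<close>

lemma excess_risk_eq: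
  fixes P :: "('a::{metric_space, second_countable_topology} \<times> bool) measure"
  assumes P: "joint_law P" and \<eta>: "regression_function P \<eta>" and g: "Measurable.pred borel g"
  shows "risk P g - risk P (bayes \<eta>) = (\<integral>x. 2 * \<bar>\<eta> x - 1/2\<bar> * of_bool (g x \<noteq> bayes \<eta> x) \<partial>marginal P)"
proof -
  interpret \<mu>: prob_space "marginal P" using P by (rule prob_space_marginal)
  note [measurable] = g
  note [measurable_cong] = sets_marginal(1)[of P]
  have \<eta>_meas[measurable]: "\<eta> \<in> borel_measurable borel" and \<eta>01: "0 \<le> \<eta> x" "\<eta> x \<le> 1" for x
    using \<eta> by (auto simp: regression_function_def)
  have bayes: "Measurable.pred borel (bayes \<eta>)" unfolding bayes_def[abs_def] by measurable
  have int: "integrable (marginal P) (\<lambda>x. if g x then 1 - \<eta> x else \<eta> x)"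
    if [measurable]: "Measurable.pred borel g" for g
    using \<eta>01 by (intro \<mu>.integrable_const_bound[where B=1]) (auto simp: abs_le_iff intro!: add_increasing)
  show ?thesis
    unfolding risk_eq[OF P \<eta> g] risk_eq[OF P \<eta> bayes]
    by (subst Bochner_Integration.integral_diff[symmetric, OF int[OF g] int[OF bayes]])
       (auto simp: bayes_def abs_if intro!: Bochner_Integration.integral_cong)
qed

subsection \<open>Excess risk and instability\<close>

lemma (in prob_space) nn_integral_pair_fst:
  assumes [measurable]: "f \<in> borel_measurable M1"
  shows "(\<integral>\<^sup>+z. f (fst z) \<partial>(M1 \<Otimes>\<^sub>M M)) = (\<integral>\<^sup>+x. f x \<partial>M1)"
  by (subst nn_integral_fst[symmetric]) (auto simp: emeasure_space_1)

lemma (in prob_space) nn_integral_pair_snd: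
  assumes "prob_space M1" and [measurable]: "f \<in> borel_measurable M"
  shows "(\<integral>\<^sup>+z. f (snd z) \<partial>(M1 \<Otimes>\<^sub>M M)) = (\<integral>\<^sup>+x. f x \<partial>M)"
  by (subst nn_integral_fst[symmetric]) (auto simp: prob_space.emeasure_space_1[OF assms(1)])

text \<open>A null ball around \<open>x\<close> contains a ball around each of its points, which is
  null too. Closedness is wanted for the measurability of the support.\<close>

lemma closed_msupport:
  fixes \<mu> :: "'a::metric_space measure"
  assumes "finite_measure \<mu>" "sets \<mu> = sets borel"
  shows "closed (msupport \<mu>)"
proof -
  interpret finite_measure \<mu> by fact
  have "open (- msupport \<mu>)"
    unfolding open_dist
  proof
    fix x assume "x \<in> - msupport \<mu>"
    then obtain r where r: "0 < r" "measure \<mu> (ball x r) \<le> 0" by (auto simp: msupport_def not_less)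
    have "y \<notin> msupport \<mu>" if y: "dist y x < r" for y
    proof -
      have "measure \<mu> (ball y (r - dist y x)) \<le> measure \<mu> (ball x r)"
      proof (intro finite_measure_mono subsetI)
        fix z assume "z \<in> ball y (r - dist y x)"
        then show "z \<in> ball x r" using dist_triangle[of x z y] by (simp add: dist_commute)
      qed (simp add: assms)
      then have "measure \<mu> (ball y (r - dist y x)) \<le> 0" using r(2) by linarith
      then show ?thesis using y by (auto simp: msupport_def not_less intro!: exI[of _ "r - dist y x"])
    qed
    then show "\<exists>e>0. \<forall>y. dist y x < e \<longrightarrow> y \<in> - msupport \<mu>" using r(1) by auto
  qed
  then show ?thesis by (simp add: closed_def)
qed

text \<open>The complement of the support is covered by null balls, and by the Lindelof property
  countably many of them have the same union.\<close>

lemma AE_msupport: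
  fixes \<mu> :: "'a::{metric_space, second_countable_topology} measure"
  assumes "finite_measure \<mu>" "sets \<mu> = sets borel"
  shows "AE x in \<mu>. x \<in> msupport \<mu>"
proof -
  interpret finite_measure \<mu> by fact
  define \<F> where "\<F> = {ball x r | x r. measure \<mu> (ball x r) = 0}"
  obtain \<G> where \<G>: "\<G> \<subseteq> \<F>" "countable \<G>" "\<Union>\<G> = \<Union>\<F>"
    using Lindelof[of \<F>] by (auto simp: \<F>_def)
  have "G \<in> null_sets \<mu>" if "G \<in> \<G>" for G
    using that \<G>(1) by (auto simp: \<F>_def null_sets_def emeasure_eq_measure assms)
  then have "\<Union>\<G> \<in> null_sets \<mu>" using \<G>(2) null_sets_UN'[of \<G> "\<lambda>G. G" \<mu>] by simp
  then have "AE x in \<mu>. x \<notin> \<Union>\<F>" unfolding \<G>(3) by (rule AE_not_in)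
  then show ?thesis
  proof eventually_elim
    case (elim x)
    have "measure \<mu> (ball x r) > 0" if "0 < r" for r
      using elim that by (auto simp: \<F>_def zero_less_measure_iff) (metis centre_in_ball measure_le_0_iff not_less)
    then show ?case by (simp add: msupport_def)
  qed
qed

text \<open>The two bounds \<open>LM\<close> express that \<open>L\<close> is half of
  \<open>M\<close>, rounded up. The upper one keeps enough blocks unselected to control the pivots,
  the lower one guarantees enough votes.\<close>

locale knn_rule =
  fixes P :: "('a::{metric_space, second_countable_topology} \<times> bool) measure" and \<eta> :: "'a \<Rightarrow> real"
    and N k M L :: nat
  assumes P: "joint_law P" and \<eta>: "regression_function P \<eta>" and ties: "no_ties P"
    and sizes: "1 \<le> k" "1 \<le> M" "M dvd N" "k + 1 \<le> N div M"
    and LM: "2 * L \<le> M + 1" "M \<le> 2 * L"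
begin

abbreviation "\<mu> \<equiv> marginal P"
abbreviation "U \<equiv> random_split N M"
abbreviation "knn D s \<equiv> selective_knn N k M L D s"
abbreviation "errs D s x \<equiv> knn D s x \<noteq> bayes \<eta> x"

definition err :: "'a \<Rightarrow> ennreal" where
  "err x = (\<integral>\<^sup>+D. (\<integral>\<^sup>+s. of_bool (errs D s x) \<partial>U) \<partial>sample P N)"

sublocale P: prob_space P using P by (simp add: joint_law_def)
sublocale \<mu>: prob_space \<mu> using P by (rule prob_space_marginal)
sublocale U: prob_space U using sizes by (intro prob_space_random_split) auto
sublocale S: prob_space "sample P N" unfolding sample_def by (intro prob_space_PiM P.prob_space_axioms)

lemma \<eta>_meas [measurable]: "\<eta> \<in> borel_measurable borel" and \<eta>01: "0 \<le> \<eta> x" "\<eta> x \<le> 1"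
  using \<eta> by (auto simp: regression_function_def)

lemma bayes_meas [measurable]: "Measurable.pred borel (bayes \<eta>)"
  unfolding bayes_def[abs_def] by measurable

lemma knn_meas [measurable (raw)]:
  assumes "D \<in> measurable \<Omega> (sample P N)" "S \<in> measurable \<Omega> U" "X \<in> measurable \<Omega> \<mu>"
  shows "Measurable.pred \<Omega> (\<lambda>\<omega>. knn (D \<omega>) (S \<omega>) (X \<omega>))"
  using assms measurable_cong_sets[OF refl sets_marginal(1), of \<Omega> P]
  by (intro measurable_selective_knn_joint[OF P]) auto

lemma bayes_meas' [measurable]: "Measurable.pred \<mu> (bayes \<eta>)"
  using measurable_cong_sets[OF sets_marginal(1) refl, of P] bayes_meas by blast

lemma err_le_1: "err x \<le> 1"
proof -
  have "err x \<le> (\<integral>\<^sup>+D. (\<integral>\<^sup>+s. 1 \<partial>U) \<partial>sample P N)"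
    unfolding err_def by (intro nn_integral_mono) auto
  then show ?thesis by (simp add: U.emeasure_space_1 S.emeasure_space_1)
qed

text \<open>After exchanging the order of integration, a bound valid for every fixed split survives
  averaging over the split.\<close>

lemma err_le:
  assumes "\<And>s. s \<in> splits N M \<Longrightarrow> emeasure (sample P N) {D \<in> space (sample P N). errs D s x} \<le> c"
  shows "err x \<le> c"
proof -
  interpret SU: pair_sigma_finite "sample P N" U by standard
  have x: "x \<in> space \<mu>" by (simp add: sets_marginal)
  have [measurable]: "(\<lambda>_. x) \<in> measurable \<Omega> \<mu>" for \<Omega> using x by simp
  have "err x = (\<integral>\<^sup>+s. (\<integral>\<^sup>+D. of_bool (errs D s x) \<partial>sample P N) \<partial>U)"
    unfolding err_def by (rule SU.Fubini'[symmetric]) measurable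
  also have "\<dots> \<le> (\<integral>\<^sup>+s. c \<partial>U)"
  proof (rule nn_integral_mono)
    fix s assume s: "s \<in> space U"
    then have [measurable]: "(\<lambda>_. s) \<in> measurable \<Omega> U" for \<Omega> by simp
    have "(\<integral>\<^sup>+D. of_bool (errs D s x) \<partial>sample P N) = (\<integral>\<^sup>+D. indicator {D \<in> space (sample P N). errs D s x} D \<partial>sample P N)"
      by (intro nn_integral_cong) (auto simp: indicator_def)
    also have "\<dots> = emeasure (sample P N) {D \<in> space (sample P N). errs D s x}"
      by (rule nn_integral_indicator) measurable
    also have "\<dots> \<le> c"
      using s by (intro assms) (simp add: random_split_def uniform_count_measure_def space_point_measure)
    finally show "(\<integral>\<^sup>+D. of_bool (errs D s x) \<partial>sample P N) \<le> c" .
  qed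
  finally show ?thesis by (simp add: U.emeasure_space_1)
qed

text \<open>Smoothness mixes the average over the closed ball with the mass of the open one; since
  spheres are null, both may be taken over the open ball. Multiplying by the mass \<open>q\<close>
  turns the average into a joint probability.\<close>

lemma ball_close:
  assumes smooth: "smooth \<mu> \<eta> \<alpha> A" and x: "x \<in> msupport \<mu>" and u: "0 < u"
  defines "q \<equiv> measure P {z. dist x (fst z) < u}"
  shows "\<bar>measure P {z. snd z \<and> dist x (fst z) < u} - \<eta> x * q\<bar> \<le> A * q powr \<alpha> * q"
proof -
  note [measurable] = joint_law_measurable[OF P]
  have null: "AE z in P. dist x (fst z) \<noteq> u"
  proof (rule AE_I)
    show "{z \<in> space P. \<not> dist x (fst z) \<noteq> u} \<subseteq> {z. dist x (fst z) = u}" by auto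
    show "emeasure P {z. dist x (fst z) = u} = 0"
      using no_ties_sphere[OF P ties] by (simp add: P.emeasure_eq_measure)
    have "{z \<in> space P. dist x (fst z) = u} \<in> sets P" by measurable
    then show "{z. dist x (fst z) = u} \<in> sets P" by (simp add: joint_law_space[OF P])
  qed
  have q: "q = measure \<mu> (ball x u)"
    unfolding q_def by (subst measure_marginal[OF P]) auto
  have "{z \<in> space P. dist x (fst z) < u} \<in> sets P" "{z \<in> space P. dist x (fst z) \<le> u} \<in> sets P"
    "{z \<in> space P. snd z \<and> dist x (fst z) < u} \<in> sets P" "{z \<in> space P. snd z \<and> dist x (fst z) \<le> u} \<in> sets P"
    by measurable
  then have sets: "{z. dist x (fst z) < u} \<in> sets P" "{z. dist x (fst z) \<le> u} \<in> sets P"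
    "{z. snd z \<and> dist x (fst z) < u} \<in> sets P" "{z. snd z \<and> dist x (fst z) \<le> u} \<in> sets P"
    by (simp_all add: joint_law_space[OF P])
  have qc: "measure \<mu> (cball x u) = q"
  proof -
    have "measure \<mu> (cball x u) = measure P {z. dist x (fst z) \<le> u}"
      by (subst measure_marginal[OF P]) auto
    also have "\<dots> = q" unfolding q_def
      using null sets by (intro measure_eq_AE) (auto elim!: eventually_mono)
    finally show ?thesis .
  qed
  have int: "(LINT y:cball x u|\<mu>. \<eta> y) = measure P {z. snd z \<and> dist x (fst z) < u}"
  proof -
    have "(LINT y:cball x u|\<mu>. \<eta> y) = measure P {z. fst z \<in> cball x u \<and> snd z}"
      unfolding set_lebesgue_integral_def by (subst regression_set[OF P \<eta>]) auto
    also have "\<dots> = measure P {z. snd z \<and> dist x (fst z) \<le> u}"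
      by (intro arg_cong[where f="measure P"]) auto
    also have "\<dots> = measure P {z. snd z \<and> dist x (fst z) < u}"
      using null sets by (intro measure_eq_AE) (auto elim!: eventually_mono)
    finally show ?thesis .
  qed
  have "\<bar>(1 / q) * measure P {z. snd z \<and> dist x (fst z) < u} - \<eta> x\<bar> \<le> A * q powr \<alpha>"
    using smooth[unfolded smooth_def, rule_format, OF x u] unfolding avg_on_def int qc q[symmetric] .
  then have "\<bar>(1 / q) * measure P {z. snd z \<and> dist x (fst z) < u} - \<eta> x\<bar> * q \<le> A * q powr \<alpha> * q"
    by (rule mult_right_mono) (simp add: q)
  moreover have q0: "0 < q" using x u by (simp add: q msupport_def)
  have "measure P {z. snd z \<and> dist x (fst z) < u} - \<eta> x * q
     = ((1 / q) * measure P {z. snd z \<and> dist x (fst z) < u} - \<eta> x) * q"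
    using q0 by (simp add: field_simps)
  then have "\<bar>measure P {z. snd z \<and> dist x (fst z) < u} - \<eta> x * q\<bar>
     = \<bar>(1 / q) * measure P {z. snd z \<and> dist x (fst z) < u} - \<eta> x\<bar> * q"
    using q0 by (simp only: abs_mult abs_of_pos)
  ultimately show ?thesis by (simp only:)
qed

text \<open>The bound for a fixed split is uniform over splits. The mass condition says that each
  block has on average at least \<open>8 k\<close> points in the ball of mass \<open>p\<close>; the
  smoothness error increases with the mass, so \<open>far\<close> covers all smaller balls.\<close>

lemma err_bound:
  assumes smooth: "smooth \<mu> \<eta> \<alpha> A" "0 \<le> \<alpha>" "0 \<le> A" and x: "x \<in> msupport \<mu>"
    and p: "0 < p" "p < 1" "8 * real (k * M) \<le> p * real N"
    and far: "A * p powr \<alpha> \<le> \<bar>\<eta> x - 1/2\<bar> / 2"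
  shows "err x \<le> ennreal (exp (- real (k * M) / 2) + exp (- (real (k * M) / 8 * \<bar>\<eta> x - 1/2\<bar>\<^sup>2)))"
proof (rule err_le)
  fix s assume s: "s \<in> splits N M"
  interpret fixed_query P N M k L s x
    using P ties s sizes LM by unfold_locales (auto simp: no_ties_def)
  have "real N = real M * real (N div M)"
    using sizes(3) by (metis dvd_mult_div_cancel of_nat_mult)
  then have np: "8 * real k \<le> p * real (N div M)"
    using p(3) sizes(2) by (simp add: mult_ac)
  show "emeasure (sample P N) {D \<in> space (sample P N). errs D s x}
     \<le> ennreal (exp (- real (k * M) / 2) + exp (- (real (k * M) / 8 * \<bar>\<eta> x - 1/2\<bar>\<^sup>2)))"
    unfolding bayes_def
  proof (rule prob_vote_ne[OF no_ties_sphere[OF P ties] p(1,2) np LM \<eta>01])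
    fix u :: real assume u: "0 < u" and q: "measure P {z. dist x (fst z) < u} \<le> p"
    have "A * measure P {z. dist x (fst z) < u} powr \<alpha> \<le> A * p powr \<alpha>"
      using q smooth by (intro mult_left_mono powr_mono2) auto
    also note far
    finally have "A * measure P {z. dist x (fst z) < u} powr \<alpha> * measure P {z. dist x (fst z) < u}
       \<le> \<bar>\<eta> x - 1/2\<bar> / 2 * measure P {z. dist x (fst z) < u}"
      by (intro mult_right_mono) auto
    with ball_close[OF smooth(1) x u]
    show "\<bar>measure P {z. snd z \<and> dist x (fst z) < u} - \<eta> x * measure P {z. dist x (fst z) < u}\<bar>
        \<le> \<bar>\<eta> x - 1/2\<bar> / 2 * measure P {z. dist x (fst z) < u}"
      by linarith
  qed
qed

text \<open>The case \<open>n = 0\<close> serves the instability, \<open>n = 1\<close> the excess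
  risk. The shell width \<open>\<delta>\<close> is at least twice the smoothness error, so
  \<open>err_bound\<close> applies outside the innermost shell. The condition on \<open>b\<close>
  expresses its exponent in units of \<open>\<delta>\<close>.\<close>

lemma integral_err_le:
  fixes n :: nat
  assumes smooth: "smooth \<mu> \<eta> \<alpha> A" "0 \<le> \<alpha>" "0 \<le> A"
    and margin: "margin \<mu> \<eta> \<beta> B" "0 \<le> B" "0 \<le> \<beta>"
    and p: "0 < p" "p < 1" "8 * real (k * M) \<le> p * real N"
    and \<delta>: "0 < \<delta>" "2 * (A * p powr \<alpha>) \<le> \<delta>" and b: "0 < b" "8 * b \<le> \<delta>\<^sup>2 * real (k * M)"
  shows "(\<integral>\<^sup>+x. ennreal (\<bar>\<eta> x - 1/2\<bar> ^ n) * err x \<partial>\<mu>)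
    \<le> ennreal (exp (- real (k * M) / 2)
        + B * (\<Sum>j. (real j + 1) powr (real n + \<beta>) * exp (- (b * (real j)\<^sup>2))) * \<delta> powr (real n + \<beta>))"
proof (rule nn_integral_peeling[where S="msupport \<mu>"])
  note [measurable_cong] = sets_marginal(1)[of P]
  show "(\<lambda>x. \<bar>\<eta> x - 1/2\<bar>) \<in> borel_measurable \<mu>" by measurable
  show "\<bar>\<eta> x - 1/2\<bar> \<le> 1" for x using \<eta>01[of x] by linarith
  show AE: "AE x in \<mu>. x \<in> msupport \<mu>"
    by (intro AE_msupport) (auto simp: sets_marginal \<mu>.finite_measure_axioms)
  have [measurable]: "msupport \<mu> \<in> sets borel"
    by (intro borel_closed closed_msupport) (auto simp: sets_marginal \<mu>.finite_measure_axioms)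
  fix t :: real assume t: "0 < t"
  \<comment> \<open>The margin condition speaks of thresholds up to \<open>1/2\<close> only. The
    distance of \<open>\<eta> x\<close> from \<open>1/2\<close> never exceeds \<open>1/2\<close>, so
    \<open>t\<close> may be truncated there.\<close>
  have "measure \<mu> {x \<in> space \<mu>. \<bar>\<eta> x - 1/2\<bar> \<le> t} = measure \<mu> {x \<in> msupport \<mu>. \<bar>\<eta> x - 1/2\<bar> \<le> min t (1/2)}"
  proof (rule measure_eq_AE)
    have half: "\<bar>\<eta> x - 1/2\<bar> \<le> 1/2" for x using \<eta>01[of x] unfolding abs_le_iff by linarith
    show "AE x in \<mu>. x \<in> {x \<in> space \<mu>. \<bar>\<eta> x - 1/2\<bar> \<le> t} \<longleftrightarrow> x \<in> {x \<in> msupport \<mu>. \<bar>\<eta> x - 1/2\<bar> \<le> min t (1/2)}"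
      using AE by eventually_elim (use half in \<open>auto simp: sets_marginal\<close>)
    have "{x \<in> space \<mu>. x \<in> msupport \<mu> \<and> \<bar>\<eta> x - 1/2\<bar> \<le> min t (1/2)} \<in> sets \<mu>" by measurable
    then show "{x \<in> msupport \<mu>. \<bar>\<eta> x - 1/2\<bar> \<le> min t (1/2)} \<in> sets \<mu>" by (simp add: sets_marginal)
  qed measurable
  also have "\<dots> \<le> B * (min t (1/2)) powr \<beta>"
    by (rule margin(1)[unfolded margin_def, rule_format]) (use t in auto)
  also have "\<dots> \<le> B * t powr \<beta>"
    using margin t by (intro mult_left_mono powr_mono2) auto
  finally show "emeasure \<mu> {x \<in> space \<mu>. \<bar>\<eta> x - 1/2\<bar> \<le> t} \<le> ennreal (B * t powr \<beta>)"
    by (simp add: \<mu>.emeasure_eq_measure ennreal_leI)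
next
  fix x assume x: "x \<in> msupport \<mu>" and le: "\<delta> \<le> \<bar>\<eta> x - 1/2\<bar>"
  have "err x \<le> ennreal (exp (- real (k * M) / 2) + exp (- (real (k * M) / 8 * \<bar>\<eta> x - 1/2\<bar>\<^sup>2)))"
    using order_trans[OF \<delta>(2) le] by (intro err_bound[OF smooth x p]) simp
  also have "\<dots> \<le> ennreal (exp (- real (k * M) / 2) + exp (- (b * (\<bar>\<eta> x - 1/2\<bar> / \<delta>)\<^sup>2)))"
  proof (rule ennreal_leI)
    have "b / \<delta>\<^sup>2 \<le> real (k * M) / 8" using b \<delta> by (simp add: field_simps)
    then have "b / \<delta>\<^sup>2 * \<bar>\<eta> x - 1/2\<bar>\<^sup>2 \<le> real (k * M) / 8 * \<bar>\<eta> x - 1/2\<bar>\<^sup>2"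
      by (intro mult_right_mono) auto
    then show "exp (- real (k * M) / 2) + exp (- (real (k * M) / 8 * \<bar>\<eta> x - 1/2\<bar>\<^sup>2))
      \<le> exp (- real (k * M) / 2) + exp (- (b * (\<bar>\<eta> x - 1/2\<bar> / \<delta>)\<^sup>2))"
      by (simp add: power_divide)
  qed
  finally show "err x \<le> ennreal (exp (- real (k * M) / 2) + exp (- (b * (\<bar>\<eta> x - 1/2\<bar> / \<delta>)\<^sup>2)))" .
qed (use margin \<delta> b err_le_1 \<mu>.prob_space_axioms in auto)

text \<open>By \<open>excess_risk_eq\<close> and an exchange of integrals, the expected excess risk
  is the integral of \<open>2 * \<bar>\<eta> x - 1/2\<bar>\<close> against \<open>err x\<close>. The
  power \<open>^ 1\<close> matches \<open>integral_err_le\<close>.\<close>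

lemma excess_risk_bound:
  assumes c: "0 \<le> c" "(\<integral>\<^sup>+x. ennreal (\<bar>\<eta> x - 1/2\<bar> ^ 1) * err x \<partial>\<mu>) \<le> ennreal c"
  shows "\<bar>expected_risk P N U (selective_knn N k M L) - risk P (bayes \<eta>)\<bar> \<le> 2 * c"
proof -
  note [measurable_cong] = sets_marginal(1)[of P]
  interpret SU: pair_prob_space "sample P N" U by standard
  interpret SU\<mu>: pair_sigma_finite "sample P N \<Otimes>\<^sub>M U" \<mu> by standard
  define h where "h w = (\<integral>x. 2 * \<bar>\<eta> x - 1/2\<bar> * of_bool (errs (fst w) (snd w) x) \<partial>\<mu>)" for w
  have sec: "Measurable.pred borel (knn D s)" if "D \<in> space (sample P N)" "s \<in> space U" for D s
    using that by (intro measurable_selective_knn_joint[OF P]) auto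
  have risk: "risk P (knn (fst w) (snd w)) = risk P (bayes \<eta>) + h w"
    if "w \<in> space (sample P N \<Otimes>\<^sub>M U)" for w
    using excess_risk_eq[OF P \<eta> sec, of "fst w" "snd w"] that by (auto simp: h_def space_pair_measure)
  have le1: "2 * \<bar>\<eta> x - 1/2\<bar> \<le> 1" for x using \<eta>01[of x] unfolding abs_if by auto
  have h0: "0 \<le> h w" for w unfolding h_def by (intro integral_nonneg_AE) auto
  have int_h: "integrable \<mu> (\<lambda>x. 2 * \<bar>\<eta> x - 1/2\<bar> * of_bool (errs (fst w) (snd w) x))"
    if "w \<in> space (sample P N \<Otimes>\<^sub>M U)" for w
  proof (rule \<mu>.integrable_const_bound[where B=1])
    have [measurable]: "Measurable.pred borel (knn (fst w) (snd w))"
      using that by (intro sec) (auto simp: space_pair_measure)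
    show "(\<lambda>x. 2 * \<bar>\<eta> x - 1/2\<bar> * of_bool (errs (fst w) (snd w) x)) \<in> borel_measurable \<mu>" by measurable
  qed (use le1 in \<open>auto simp: of_bool_def\<close>)
  have h1: "h w \<le> 1" if "w \<in> space (sample P N \<Otimes>\<^sub>M U)" for w
  proof -
    have "h w \<le> (\<integral>x. 1 \<partial>\<mu>)"
      unfolding h_def using int_h[OF that] le1 by (intro integral_mono) (auto simp: of_bool_def)
    then show ?thesis by (simp add: \<mu>.prob_space)
  qed
  have [measurable]: "h \<in> borel_measurable (sample P N \<Otimes>\<^sub>M U)"
    unfolding h_def by measurable
  have int: "integrable (sample P N \<Otimes>\<^sub>M U) h"
    using h0 h1 by (intro SU.integrable_const_bound[where B=1]) (auto intro!: AE_I2)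
  have "expected_risk P N U (selective_knn N k M L) = (\<integral>w. risk P (bayes \<eta>) + h w \<partial>(sample P N \<Otimes>\<^sub>M U))"
    unfolding expected_risk_def case_prod_beta by (intro Bochner_Integration.integral_cong risk) auto
  also have "\<dots> = risk P (bayes \<eta>) + (\<integral>w. h w \<partial>(sample P N \<Otimes>\<^sub>M U))"
    using int by (subst Bochner_Integration.integral_add) (auto simp: SU.prob_space)
  finally have eq: "expected_risk P N U (selective_knn N k M L) - risk P (bayes \<eta>) = (\<integral>w. h w \<partial>(sample P N \<Otimes>\<^sub>M U))"
    by simp
  have "(\<integral>\<^sup>+w. ennreal (h w) \<partial>(sample P N \<Otimes>\<^sub>M U))
     = (\<integral>\<^sup>+w. (\<integral>\<^sup>+x. 2 * ennreal \<bar>\<eta> x - 1/2\<bar> * of_bool (errs (fst w) (snd w) x) \<partial>\<mu>) \<partial>(sample P N \<Otimes>\<^sub>M U))"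
  proof (rule nn_integral_cong)
    fix w assume w: "w \<in> space (sample P N \<Otimes>\<^sub>M U)"
    have "ennreal (h w) = (\<integral>\<^sup>+x. ennreal (2 * \<bar>\<eta> x - 1/2\<bar> * of_bool (errs (fst w) (snd w) x)) \<partial>\<mu>)"
      unfolding h_def using int_h[OF w] by (intro nn_integral_eq_integral[symmetric]) auto
    also have "\<dots> = (\<integral>\<^sup>+x. 2 * ennreal \<bar>\<eta> x - 1/2\<bar> * of_bool (errs (fst w) (snd w) x) \<partial>\<mu>)"
      by (intro nn_integral_cong) (auto simp: of_bool_def ennreal_mult')
    finally show "ennreal (h w) = \<dots>" .
  qed
  also have "\<dots> = (\<integral>\<^sup>+x. (\<integral>\<^sup>+w. 2 * ennreal \<bar>\<eta> x - 1/2\<bar> * of_bool (errs (fst w) (snd w) x) \<partial>(sample P N \<Otimes>\<^sub>M U)) \<partial>\<mu>)"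
    by (rule SU\<mu>.Fubini'[symmetric]) measurable
  also have "\<dots> = (\<integral>\<^sup>+x. 2 * (ennreal \<bar>\<eta> x - 1/2\<bar> * err x) \<partial>\<mu>)"
  proof (rule nn_integral_cong)
    fix x assume x: "x \<in> space \<mu>"
    then have [measurable]: "(\<lambda>_. x) \<in> measurable \<Omega> \<mu>" for \<Omega> by simp
    have "(\<integral>\<^sup>+w. of_bool (errs (fst w) (snd w) x) \<partial>(sample P N \<Otimes>\<^sub>M U)) = err x"
      unfolding err_def by (subst U.nn_integral_fst[symmetric]) auto
    then show "(\<integral>\<^sup>+w. 2 * ennreal \<bar>\<eta> x - 1/2\<bar> * of_bool (errs (fst w) (snd w) x) \<partial>(sample P N \<Otimes>\<^sub>M U)) = 2 * (ennreal \<bar>\<eta> x - 1/2\<bar> * err x)"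
      by (subst nn_integral_cmult) (auto simp: mult.assoc)
  qed
  also have "\<dots> = 2 * (\<integral>\<^sup>+x. ennreal \<bar>\<eta> x - 1/2\<bar> * err x \<partial>\<mu>)"
    unfolding err_def by (rule nn_integral_cmult) measurable
  also have "\<dots> \<le> 2 * ennreal c" using c(2) by (intro mult_left_mono) auto
  also have "\<dots> = ennreal (2 * c)" using c(1) by (simp add: ennreal_mult')
  finally have "(\<integral>w. h w \<partial>(sample P N \<Otimes>\<^sub>M U)) \<le> 2 * c"
    using c(1) by (intro integral_real_bounded) auto
  moreover have "0 \<le> (\<integral>w. h w \<partial>(sample P N \<Otimes>\<^sub>M U))"
    using h0 by (intro integral_nonneg_AE) auto
  ultimately show ?thesis unfolding eq by simp
qed

text \<open>Two classifiers that differ at \<open>x\<close> cannot both agree with the Bayes rule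
  there. Each of the two data sets, with its own split, therefore contributes at most
  \<open>c\<close>.\<close>

lemma CIS_bound:
  assumes c: "0 \<le> c" "(\<integral>\<^sup>+x. err x \<partial>\<mu>) \<le> ennreal c"
  shows "\<bar>CIS P N U (selective_knn N k M L)\<bar> \<le> 2 * c"
proof -
  note [measurable_cong] = sets_marginal(1)[of P]
  interpret UU: pair_prob_space U U by standard
  interpret T: pair_prob_space \<mu> "U \<Otimes>\<^sub>M U" by standard
  interpret S\<mu>: pair_sigma_finite "sample P N" \<mu> by standard
  define H where "H D = (\<integral>\<^sup>+x. (\<integral>\<^sup>+s. of_bool (errs D s x) \<partial>U) \<partial>\<mu>)" for D
  have H_meas[measurable]: "H \<in> borel_measurable (sample P N)"
    unfolding H_def by measurable
  have H: "(\<integral>\<^sup>+D. H D \<partial>sample P N) \<le> ennreal c"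
  proof -
    have "(\<integral>\<^sup>+D. H D \<partial>sample P N) = (\<integral>\<^sup>+x. err x \<partial>\<mu>)"
      unfolding H_def err_def by (rule S\<mu>.Fubini'[symmetric]) measurable
    then show ?thesis using c by simp
  qed
  let ?d = "\<lambda>D D'. \<P>((x, s, s') in \<mu> \<Otimes>\<^sub>M (U \<Otimes>\<^sub>M U). knn D s x \<noteq> knn D' s' x)"
  have d_le: "ennreal (?d D D') \<le> H D + H D'" if D: "D \<in> space (sample P N)" "D' \<in> space (sample P N)" for D D'
  proof -
    have [measurable]: "(\<lambda>_. D) \<in> measurable \<Omega> (sample P N)" "(\<lambda>_. D') \<in> measurable \<Omega> (sample P N)" for \<Omega>
      using D by auto
    have set: "{z \<in> space (\<mu> \<Otimes>\<^sub>M (U \<Otimes>\<^sub>M U)). case z of (x, s, s') \<Rightarrow> knn D s x \<noteq> knn D' s' x} \<in> sets (\<mu> \<Otimes>\<^sub>M (U \<Otimes>\<^sub>M U))"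
      unfolding case_prod_beta by measurable
    have "?d D D' = measure (\<mu> \<Otimes>\<^sub>M (U \<Otimes>\<^sub>M U)) {z \<in> space (\<mu> \<Otimes>\<^sub>M (U \<Otimes>\<^sub>M U)). case z of (x, s, s') \<Rightarrow> knn D s x \<noteq> knn D' s' x}"
      by (intro arg_cong[where f="measure _"]) auto
    then have "ennreal (?d D D') = (\<integral>\<^sup>+z. indicator {z \<in> space (\<mu> \<Otimes>\<^sub>M (U \<Otimes>\<^sub>M U)). case z of (x, s, s') \<Rightarrow> knn D s x \<noteq> knn D' s' x} z \<partial>(\<mu> \<Otimes>\<^sub>M (U \<Otimes>\<^sub>M U)))"
      by (simp only: nn_integral_indicator[OF set] T.emeasure_eq_measure)
    also have "\<dots> \<le> (\<integral>\<^sup>+z. of_bool (errs D (fst (snd z)) (fst z)) + of_bool (errs D' (snd (snd z)) (fst z)) \<partial>(\<mu> \<Otimes>\<^sub>M (U \<Otimes>\<^sub>M U)))"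
      by (intro nn_integral_mono) (auto simp: indicator_def)
    also have "\<dots> = (\<integral>\<^sup>+z. of_bool (errs D (fst (snd z)) (fst z)) \<partial>(\<mu> \<Otimes>\<^sub>M (U \<Otimes>\<^sub>M U)))
        + (\<integral>\<^sup>+z. of_bool (errs D' (snd (snd z)) (fst z)) \<partial>(\<mu> \<Otimes>\<^sub>M (U \<Otimes>\<^sub>M U)))"
      by (rule nn_integral_add) measurable
    also have "(\<integral>\<^sup>+z. of_bool (errs D (fst (snd z)) (fst z)) \<partial>(\<mu> \<Otimes>\<^sub>M (U \<Otimes>\<^sub>M U))) = H D"
    proof -
      have "(\<integral>\<^sup>+z. of_bool (errs D (fst (snd z)) (fst z)) \<partial>(\<mu> \<Otimes>\<^sub>M (U \<Otimes>\<^sub>M U)))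
         = (\<integral>\<^sup>+x. (\<integral>\<^sup>+w. of_bool (errs D (fst w) x) \<partial>(U \<Otimes>\<^sub>M U)) \<partial>\<mu>)"
        by (subst UU.nn_integral_fst[symmetric]) auto
      also have "\<dots> = H D"
        unfolding H_def
      proof (rule nn_integral_cong)
        fix x assume "x \<in> space \<mu>"
        then have [measurable]: "(\<lambda>_. x) \<in> measurable \<Omega> \<mu>" for \<Omega> by simp
        show "(\<integral>\<^sup>+w. of_bool (errs D (fst w) x) \<partial>(U \<Otimes>\<^sub>M U)) = (\<integral>\<^sup>+s. of_bool (errs D s x) \<partial>U)"
          by (rule U.nn_integral_pair_fst) measurable
      qed
      finally show ?thesis .
    qed
    also have "(\<integral>\<^sup>+z. of_bool (errs D' (snd (snd z)) (fst z)) \<partial>(\<mu> \<Otimes>\<^sub>M (U \<Otimes>\<^sub>M U))) = H D'"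
    proof -
      have "(\<integral>\<^sup>+z. of_bool (errs D' (snd (snd z)) (fst z)) \<partial>(\<mu> \<Otimes>\<^sub>M (U \<Otimes>\<^sub>M U)))
         = (\<integral>\<^sup>+x. (\<integral>\<^sup>+w. of_bool (errs D' (snd w) x) \<partial>(U \<Otimes>\<^sub>M U)) \<partial>\<mu>)"
        by (subst UU.nn_integral_fst[symmetric]) auto
      also have "\<dots> = H D'"
        unfolding H_def
      proof (rule nn_integral_cong)
        fix x assume "x \<in> space \<mu>"
        then have [measurable]: "(\<lambda>_. x) \<in> measurable \<Omega> \<mu>" for \<Omega> by simp
        show "(\<integral>\<^sup>+w. of_bool (errs D' (snd w) x) \<partial>(U \<Otimes>\<^sub>M U)) = (\<integral>\<^sup>+s. of_bool (errs D' s x) \<partial>U)"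
          by (rule U.nn_integral_pair_snd[OF U.prob_space_axioms]) measurable
      qed
      finally show ?thesis .
    qed
    finally show ?thesis .
  qed
  have "(\<integral>\<^sup>+w. ennreal (case w of (D, D') \<Rightarrow> ?d D D') \<partial>(sample P N \<Otimes>\<^sub>M sample P N))
     \<le> (\<integral>\<^sup>+w. H (fst w) + H (snd w) \<partial>(sample P N \<Otimes>\<^sub>M sample P N))"
    using d_le by (intro nn_integral_mono) (auto simp: space_pair_measure)
  also have "\<dots> = (\<integral>\<^sup>+D. H D \<partial>sample P N) + (\<integral>\<^sup>+D. H D \<partial>sample P N)"
    by (subst nn_integral_add)
       (auto simp: S.nn_integral_pair_fst S.nn_integral_pair_snd[OF S.prob_space_axioms])
  also have "\<dots> \<le> ennreal c + ennreal c" using H by (intro add_mono)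
  also have "\<dots> = ennreal (2 * c)" using c(1) by (simp flip: ennreal_plus)
  finally have "CIS P N U (selective_knn N k M L) \<le> 2 * c"
    unfolding CIS_def using c(1) by (intro integral_real_bounded) auto
  moreover have "0 \<le> CIS P N U (selective_knn N k M L)"
    unfolding CIS_def by (intro integral_nonneg_AE) (auto simp: measure_nonneg)
  ultimately show ?thesis by simp
qed

end

subsection \<open>Rates\<close>

lemma exp_powr_bigo:
  fixes c \<kappa> q :: real
  assumes "0 < c" "0 < \<kappa>"
  shows "(\<lambda>N. exp (- (c * real N powr \<kappa>))) \<in> O(\<lambda>N. real N powr (- q))"
  using assms by real_asymp

lemma eventually_sizes_to_infinity:
  "\<forall>\<^sub>F N in sizes_to_infinity k M. 1 \<le> k N \<and> 1 \<le> M N \<and> M N dvd N \<and> k N + 1 \<le> N div M N"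
  unfolding sizes_to_infinity_def eventually_inf_principal by auto

lemma sizes_to_infinity_le: "sizes_to_infinity k M \<le> at_top"
  unfolding sizes_to_infinity_def by simp

lemma half_selection:
  assumes "L = nat \<lceil>(1 - 1/2) * real M\<rceil>"
  shows "2 * L \<le> M + 1" "M \<le> 2 * L"
proof -
  define y where "y = (1 - 1/2) * real M"
  have "real L = real_of_int \<lceil>y\<rceil>" using assms by (simp add: y_def)
  then have "real L - 1 < y" "y \<le> real L" using ceiling_correct[of y] by simp_all
  moreover have "real M = 2 * y" by (simp add: y_def)
  ultimately have "2 * real L < real M + 2" "real M \<le> 2 * real L" by simp_all
  then show "2 * L \<le> M + 1" "M \<le> 2 * L" by linarith+
qed

theorem corollary10:
  fixes P :: "('a::{metric_space, second_countable_topology} \<times> bool) measure"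
    and \<eta> :: "'a \<Rightarrow> real" and \<alpha> A \<beta> B :: real
  assumes "joint_law P"
    and "regression_function P \<eta>"
    and "no_ties P"
    and "0 < \<alpha>" "\<alpha> \<le> 1" "0 < A" "smooth (marginal P) \<eta> \<alpha> A"
    and "0 \<le> \<beta>" "0 < B" "margin (marginal P) \<eta> \<beta> B"
  shows "\<exists>c\<in>{0<..<1::real}. \<forall>(k :: nat \<Rightarrow> nat) (M :: nat \<Rightarrow> nat) (L :: nat \<Rightarrow> nat).
    (\<forall>N. L N = nat \<lceil>(1 - c) * real (M N)\<rceil>) \<longrightarrow>
    (\<lambda>N. real (k N * M N))
      \<in> \<Theta>[sizes_to_infinity k M](\<lambda>N. real N powr (2 * \<alpha> / (2 * \<alpha> + 1))) \<longrightarrow>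
    (\<lambda>N. expected_risk P N (random_split N (M N)) (selective_knn N (k N) (M N) (L N))
          - risk P (bayes \<eta>))
      \<in> O[sizes_to_infinity k M](\<lambda>N. real N powr (- (\<alpha> * (\<beta> + 1) / (2 * \<alpha> + 1)))) \<and>
    (\<lambda>N. CIS P N (random_split N (M N)) (selective_knn N (k N) (M N) (L N)))
      \<in> O[sizes_to_infinity k M](\<lambda>N. real N powr (- (\<alpha> * \<beta> / (2 * \<alpha> + 1))))"
proof (intro bexI[of _ "1/2"] allI impI)
  fix k M L :: "nat \<Rightarrow> nat"
  assume L: "\<forall>N. L N = nat \<lceil>(1 - 1/2) * real (M N)\<rceil>"
    and \<Theta>: "(\<lambda>N. real (k N * M N)) \<in> \<Theta>[sizes_to_infinity k M](\<lambda>N. real N powr (2 * \<alpha> / (2 * \<alpha> + 1)))"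
  let ?F = "sizes_to_infinity k M"
  \<comment> \<open>With \<open>k M\<close> of order \<open>N powr (2 \<kappa>)\<close>, the noise
    \<open>(k M) powr (- 1/2)\<close> has order \<open>N powr (- \<kappa>)\<close>. The identity
    \<open>\<alpha> * (2 * \<kappa> - 1) = - \<kappa>\<close> says that the smoothness error at mass
    \<open>k M / N\<close> has the same order.\<close>
  define \<kappa> where "\<kappa> = \<alpha> / (2 * \<alpha> + 1)"
  have \<kappa>: "0 < \<kappa>" "2 * \<alpha> / (2 * \<alpha> + 1) = 2 * \<kappa>" "\<alpha> * (2 * \<kappa> - 1) = - \<kappa>" "2 * \<kappa> < 1"
    using \<open>0 < \<alpha>\<close> by (simp_all add: \<kappa>_def field_simps)
  obtain c1 where c1: "0 < c1" "\<forall>\<^sub>F N in ?F. c1 * real N powr (2 * \<kappa>) \<le> real (k N * M N)"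
    using bigthetaD2[OF \<Theta>] by (elim landau_omega.bigE) (auto simp: \<kappa>)
  obtain c2 where c2: "0 < c2" "\<forall>\<^sub>F N in ?F. real (k N * M N) \<le> c2 * real N powr (2 * \<kappa>)"
    using bigthetaD1[OF \<Theta>] by (elim landau_o.bigE) (auto simp: \<kappa>)
  \<comment> \<open>For \<open>p = 8 * c2 * real N powr (2 * \<kappa> - 1)\<close> this makes
    \<open>2 * (A * p powr \<alpha>)\<close> equal to
    \<open>\<delta> = d * real N powr (- \<kappa>)\<close>. Then \<open>b\<close> is chosen so that
    \<open>8 * b\<close> equals \<open>\<delta>\<^sup>2\<close> times the lower bound for
    \<open>k M\<close>; it does not depend on \<open>N\<close>, and so neither does the series in
    \<open>C\<close>.\<close>
  define d where "d = 2 * A * (8 * c2) powr \<alpha>"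
  define b where "b = c1 * d\<^sup>2 / 8"
  have db: "0 < d" "0 < b" using c1(1) c2(1) \<open>0 < A\<close> by (simp_all add: d_def b_def)
  define C where "C n = B * (\<Sum>j. (real j + 1) powr (real n + \<beta>) * exp (- (b * (real j)\<^sup>2))) * d powr (real n + \<beta>)" for n :: nat
  define X where "X n N = exp (- (c1 / 2 * real N powr (2 * \<kappa>))) + C n * real N powr (- (\<kappa> * (real n + \<beta>)))" for n N :: nat
  have C0: "0 \<le> C n" for n
    using summable_powr_exp_sq[OF db(2)] \<open>0 < B\<close> unfolding C_def
    by (intro mult_nonneg_nonneg suminf_nonneg) auto
  have X0: "0 \<le> X n N" for n N using C0 by (simp add: X_def)
  have rule: "\<forall>\<^sub>F N in ?F. knn_rule P \<eta> N (k N) (M N) (L N)"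
    using eventually_sizes_to_infinity
    by eventually_elim (use assms half_selection L in \<open>auto intro!: knn_rule.intro\<close>)
  \<comment> \<open>The mass \<open>p\<close> has to be below 1 for a ball of that mass to be found;
    it tends to 0 because \<open>2 * \<kappa> < 1\<close>.\<close>
  have small: "\<forall>\<^sub>F N in ?F. 0 < N \<and> 8 * c2 * real N powr (2 * \<kappa> - 1) < 1"
  proof (rule filter_leD[OF sizes_to_infinity_le])
    have "((\<lambda>N. 8 * c2 * real N powr (2 * \<kappa> - 1)) \<longlongrightarrow> 8 * c2 * 0) at_top"
      using \<kappa>(4) by (intro tendsto_mult tendsto_const tendsto_neg_powr filterlim_real_sequentially) simp
    then have "\<forall>\<^sub>F N in at_top. 8 * c2 * real N powr (2 * \<kappa> - 1) < 1"
      by (rule order_tendstoD) simp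
    then show "\<forall>\<^sub>F N in at_top. 0 < N \<and> 8 * c2 * real N powr (2 * \<kappa> - 1) < 1"
      using eventually_gt_at_top[of 0] by eventually_elim auto
  qed
  have key: "\<forall>\<^sub>F N in ?F. (\<integral>\<^sup>+x. ennreal (\<bar>\<eta> x - 1/2\<bar> ^ n) * knn_rule.err P \<eta> N (k N) (M N) (L N) x \<partial>marginal P)
      \<le> ennreal (X n N)" for n :: nat
    using rule small c1(2) c2(2)
  proof eventually_elim
    case (elim N)
    interpret knn_rule P \<eta> N "k N" "M N" "L N" by fact
    define p where "p = 8 * c2 * real N powr (2 * \<kappa> - 1)"
    define \<delta> where "\<delta> = d * real N powr (- \<kappa>)"
    have N: "0 < real N" using elim by simp
    have "(\<integral>\<^sup>+x. ennreal (\<bar>\<eta> x - 1/2\<bar> ^ n) * err x \<partial>marginal P)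
      \<le> ennreal (exp (- real (k N * M N) / 2)
        + B * (\<Sum>j. (real j + 1) powr (real n + \<beta>) * exp (- (b * (real j)\<^sup>2))) * \<delta> powr (real n + \<beta>))"
    proof (rule integral_err_le)
      show "0 < p" "p < 1" using c2(1) N elim by (simp_all add: p_def)
      have "8 * real (k N * M N) \<le> 8 * (c2 * real N powr (2 * \<kappa>))" using elim by simp
      also have "\<dots> = p * real N"
        using N powr_add[of "real N" "2 * \<kappa> - 1" 1] by (simp add: p_def)
      finally show "8 * real (k N * M N) \<le> p * real N" .
      show "0 < \<delta>" using db N by (simp add: \<delta>_def)
      have "p powr \<alpha> = (8 * c2) powr \<alpha> * real N powr (- \<kappa>)"
        unfolding p_def using c2(1) \<kappa>(3) by (simp add: powr_mult powr_powr mult.commute)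
      then show "2 * (A * p powr \<alpha>) \<le> \<delta>" by (simp add: \<delta>_def d_def)
      show "0 < b" by (rule db)
      have "8 * b = d\<^sup>2 * (real N powr (- \<kappa>))\<^sup>2 * (c1 * real N powr (2 * \<kappa>))"
      proof -
        have "(real N powr (- \<kappa>))\<^sup>2 * real N powr (2 * \<kappa>) = 1"
          using N by (simp add: power2_eq_square flip: powr_add)
        then show ?thesis by (simp add: b_def mult_ac)
      qed
      also have "\<dots> \<le> d\<^sup>2 * (real N powr (- \<kappa>))\<^sup>2 * real (k N * M N)"
        using elim by (intro mult_left_mono) auto
      finally show "8 * b \<le> \<delta>\<^sup>2 * real (k N * M N)" by (simp add: \<delta>_def power_mult_distrib)
    qed (use assms in auto)
    also have "\<dots> \<le> ennreal (X n N)"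
    proof (rule ennreal_leI)
      have "\<delta> powr (real n + \<beta>) = d powr (real n + \<beta>) * real N powr (- (\<kappa> * (real n + \<beta>)))"
        unfolding \<delta>_def using db N by (simp add: powr_mult powr_powr)
      moreover have "exp (- real (k N * M N) / 2) \<le> exp (- (c1 / 2 * real N powr (2 * \<kappa>)))"
        using elim by simp
      ultimately show "exp (- real (k N * M N) / 2)
          + B * (\<Sum>j. (real j + 1) powr (real n + \<beta>) * exp (- (b * (real j)\<^sup>2))) * \<delta> powr (real n + \<beta>) \<le> X n N"
        by (simp add: X_def C_def mult.assoc)
    qed
    finally show ?case .
  qed
  \<comment> \<open>The exponential term decays faster than every power of \<open>N\<close>, so the
    margin term determines the rate.\<close>
  have X_bigo: "X n \<in> O[?F](\<lambda>N. real N powr (- (\<kappa> * (real n + \<beta>))))" for n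
  proof (rule landau_o.big.filter_mono[OF sizes_to_infinity_le])
    show "X n \<in> O(\<lambda>N. real N powr (- (\<kappa> * (real n + \<beta>))))"
      unfolding X_def using c1(1) \<kappa>(1) by (intro sum_in_bigo exp_powr_bigo) auto
  qed
  show "(\<lambda>N. expected_risk P N (random_split N (M N)) (selective_knn N (k N) (M N) (L N)) - risk P (bayes \<eta>))
      \<in> O[?F](\<lambda>N. real N powr (- (\<alpha> * (\<beta> + 1) / (2 * \<alpha> + 1)))) \<and>
    (\<lambda>N. CIS P N (random_split N (M N)) (selective_knn N (k N) (M N) (L N)))
      \<in> O[?F](\<lambda>N. real N powr (- (\<alpha> * \<beta> / (2 * \<alpha> + 1))))"
  proof
    have "(\<lambda>N. expected_risk P N (random_split N (M N)) (selective_knn N (k N) (M N) (L N)) - risk P (bayes \<eta>)) \<in> O[?F](X 1)"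
    proof (rule landau_o.bigI)
      show "\<forall>\<^sub>F N in ?F. norm (expected_risk P N (random_split N (M N)) (selective_knn N (k N) (M N) (L N)) - risk P (bayes \<eta>)) \<le> 2 * norm (X 1 N)"
        using rule key[of 1]
        by eventually_elim (use X0 in \<open>auto dest!: knn_rule.excess_risk_bound[OF _ X0]\<close>)
    qed simp
    also note X_bigo
    also have "- (\<kappa> * (real 1 + \<beta>)) = - (\<alpha> * (\<beta> + 1) / (2 * \<alpha> + 1))" by (simp add: \<kappa>_def)
    finally show "(\<lambda>N. expected_risk P N (random_split N (M N)) (selective_knn N (k N) (M N) (L N)) - risk P (bayes \<eta>))
      \<in> O[?F](\<lambda>N. real N powr (- (\<alpha> * (\<beta> + 1) / (2 * \<alpha> + 1))))" .
    have "(\<lambda>N. CIS P N (random_split N (M N)) (selective_knn N (k N) (M N) (L N))) \<in> O[?F](X 0)"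
    proof (rule landau_o.bigI)
      show "\<forall>\<^sub>F N in ?F. norm (CIS P N (random_split N (M N)) (selective_knn N (k N) (M N) (L N))) \<le> 2 * norm (X 0 N)"
        using rule key[of 0]
        by eventually_elim (use X0 in \<open>auto dest!: knn_rule.CIS_bound[OF _ X0]\<close>)
    qed simp
    also note X_bigo
    also have "- (\<kappa> * (real 0 + \<beta>)) = - (\<alpha> * \<beta> / (2 * \<alpha> + 1))" by (simp add: \<kappa>_def)
    finally show "(\<lambda>N. CIS P N (random_split N (M N)) (selective_knn N (k N) (M N) (L N)))
      \<in> O[?F](\<lambda>N. real N powr (- (\<alpha> * \<beta> / (2 * \<alpha> + 1))))" .
  qed
qed simp

end
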